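(* Let $L \subseteq 1\{0,1\}^*$. If $L \in \mathrm{NTIME}(2^n)$, then $\mathrm{pad}(L) = \{\mathrm{pad}(w) \mid w \in L\}$ is accepted by a nondeterministic real-time Turing machine.
   Context: For a binary word $w \in 1\{0,1\}^*$ the padded string $\mathrm{pad}(w) \in \{a\}^*$ is defined recursively by $\mathrm{pad}(1) = a$, $\mathrm{pad}(w'0) = \mathrm{pad}(w')^2$ and $\mathrm{pad}(w'1) = \mathrm{pad}(w')^2 a$ (here $u^2 = uu$ denotes concatenation); equivalently $\mathrm{pad}(w) = a^m$ where $m$ is the number with binary representation $w$. $\mathrm{NTIME}(2^n)$ is the class of languages accepted by nondeterministic multitape Turing machines in time $2^n$ on inputs of length $n$. A real-time Turing machine is a (possibly nondeterministic) multitape Turing machine with a one-way read-only input tape and finitely many work tapes which reads one input symbol in every step, so that its computation on an input of length $n$ consists of exactly $n$ steps; it accepts an input if some computation ends, after the whole input has been read, in a final state with empty storage. *)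

theory Defs
  imports Main
begin

datatype bit = Zero | One

datatype letter = Letter_a

instance bit :: finite
proof
  have "(UNIV :: bit set) = {Zero, One}"
    by (auto intro: bit.exhaust)
  then show "finite (UNIV :: bit set)"
    by (metis finite.emptyI finite.insertI)
qed

instance letter :: finite
proof
  have "(UNIV :: letter set) = {Letter_a}"
    by (auto intro: letter.exhaust)
  then show "finite (UNIV :: letter set)"
    by (metis finite.emptyI finite.insertI)
qed

text \<open>Words are written with the most significant bit first, so the recursion of \<open>pad\<close> runs from
  the right end of the list and is expressed by a left fold; the recursion equations are
  \<open>pad_One\<close>, \<open>pad_snoc_Zero\<close> and \<open>pad_snoc_One\<close> below.\<close>

definition pad :: "bit list \<Rightarrow> letter list" where
  "pad w = foldl (\<lambda>u b. case b of Zero \<Rightarrow> u @ u | One \<Rightarrow> u @ u @ [Letter_a]) [] w"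

lemma pad_One: "pad [One] = [Letter_a]"
  by (simp add: pad_def)

lemma pad_snoc_Zero: "pad (w @ [Zero]) = pad w @ pad w"
  by (simp add: pad_def)

lemma pad_snoc_One: "pad (w @ [One]) = pad w @ pad w @ [Letter_a]"
  by (simp add: pad_def)

lemma length_pad: "length (pad w) = horner_sum (\<lambda>b. of_bool (b = One)) 2 (rev w)"
proof (induction w rule: rev_induct)
  case (snoc b w)
  then show ?case
    by (cases b) (simp_all add: pad_snoc_Zero pad_snoc_One)
qed (simp add: pad_def)


section \<open>Tapes\<close>

datatype 'a symbol = Blank | Input 'a | Work nat

datatype move = Move_Left | Stay | Move_Right

text \<open>A tape is infinite in both directions and is given by its contents and its head position.\<close>

type_synonym 'a tape = "(int \<Rightarrow> 'a symbol) \<times> int"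

type_synonym 'a action = "'a symbol \<times> move"

definition blank_tape :: "'a tape" where
  "blank_tape = ((\<lambda>_. Blank), 0)"

definition input_tape :: "'a list \<Rightarrow> 'a tape" where
  "input_tape w = ((\<lambda>i. if 0 \<le> i \<and> i < int (length w) then Input (w ! nat i) else Blank), 0)"

definition tape_empty :: "'a tape \<Rightarrow> bool" where
  "tape_empty t \<longleftrightarrow> (\<forall>i. fst t i = Blank)"

definition read :: "'a tape \<Rightarrow> 'a symbol" where
  "read t = fst t (snd t)"

fun offset :: "move \<Rightarrow> int" where
  "offset Move_Left = - 1"
| "offset Stay = 0"
| "offset Move_Right = 1"

fun act :: "'a action \<Rightarrow> 'a tape \<Rightarrow> 'a tape" where
  "act (x, d) (f, p) = (f(p := x), p + offset d)"


section \<open>Machines\<close>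

text \<open>A configuration consists of the state and the list of tapes.\<close>

type_synonym 'a config = "nat \<times> 'a tape list"

record 'a machine =
  num_tapes :: nat
  states :: "nat set"
  alphabet :: "'a symbol set"
  init :: nat
  final :: "nat set"

definition machine_ok :: "('a, 'm) machine_scheme \<Rightarrow> bool" where
  "machine_ok M \<longleftrightarrow>
     finite (states M) \<and> init M \<in> states M \<and> final M \<subseteq> states M \<and>
     finite (alphabet M) \<and> Blank \<in> alphabet M"

definition symbol_tuples :: "('a, 'm) machine_scheme \<Rightarrow> 'a symbol list set" where
  "symbol_tuples M = {xs. length xs = num_tapes M \<and> set xs \<subseteq> alphabet M}"

definition action_tuples :: "('a, 'm) machine_scheme \<Rightarrow> 'a action list set" where
  "action_tuples M = {as. length as = num_tapes M \<and> set as \<subseteq> alphabet M \<times> UNIV}"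


section \<open>Nondeterministic multitape Turing machines and \<open>NTIME\<close>\<close>

text \<open>The input is initially written on the first tape.  A transition consists of the state, the
  scanned symbols, the new state, and for each tape the symbol to be written and the head move.\<close>

record 'a ntm = "'a machine" +
  ntm_trans :: "(nat \<times> 'a symbol list \<times> nat \<times> 'a action list) set"

definition is_ntm :: "('a::finite) ntm \<Rightarrow> bool" where
  "is_ntm M \<longleftrightarrow> machine_ok M \<and> 1 \<le> num_tapes M \<and> range Input \<subseteq> alphabet M \<and>
     ntm_trans M \<subseteq> states M \<times> symbol_tuples M \<times> states M \<times> action_tuples M"

inductive ntm_step :: "('a::finite) ntm \<Rightarrow> 'a config \<Rightarrow> 'a config \<Rightarrow> bool" for M where
  "(q, map read ts, q', as) \<in> ntm_trans M \<Longrightarrow> ntm_step M (q, ts) (q', map2 act as ts)"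

definition ntm_init :: "('a::finite) ntm \<Rightarrow> 'a list \<Rightarrow> 'a config" where
  "ntm_init M w = (init M, input_tape w # replicate (num_tapes M - 1) blank_tape)"

definition ntm_accepts_in :: "('a::finite) ntm \<Rightarrow> 'a list \<Rightarrow> nat \<Rightarrow> bool" where
  "ntm_accepts_in M w n \<longleftrightarrow> (\<exists>c. (ntm_step M ^^ n) (ntm_init M w) c \<and> fst c \<in> final M)"

definition ntm_language :: "('a::finite) ntm \<Rightarrow> 'a list set" where
  "ntm_language M = {w. \<exists>n. ntm_accepts_in M w n}"

text \<open>As usual for nondeterministic machines, the time bound concerns a shortest accepting
  computation of each accepted word; other computations may be longer.\<close>

definition NTIME :: "(nat \<Rightarrow> nat) \<Rightarrow> ('a::finite) list set set" where
  "NTIME t = {L. \<exists>M. is_ntm M \<and> ntm_language M = L \<and>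
                     (\<forall>w\<in>L. \<exists>n\<le>t (length w). ntm_accepts_in M w n)}"


section \<open>Nondeterministic real-time Turing machines\<close>

text \<open>The tapes of the configuration are the work tapes.  The one-way input tape is represented by
  the word that labels a run: each step consumes exactly one input symbol, which is the second
  component of a transition.\<close>

record 'a rtm = "'a machine" +
  rtm_trans :: "(nat \<times> 'a \<times> 'a symbol list \<times> nat \<times> 'a action list) set"

definition is_rtm :: "('a::finite) rtm \<Rightarrow> bool" where
  "is_rtm M \<longleftrightarrow> machine_ok M \<and>
     rtm_trans M \<subseteq> states M \<times> UNIV \<times> symbol_tuples M \<times> states M \<times> action_tuples M"

inductive rtm_step :: "('a::finite) rtm \<Rightarrow> 'a \<Rightarrow> 'a config \<Rightarrow> 'a config \<Rightarrow> bool" for M where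
  "(q, a, map read ts, q', as) \<in> rtm_trans M \<Longrightarrow> rtm_step M a (q, ts) (q', map2 act as ts)"

inductive rtm_run :: "('a::finite) rtm \<Rightarrow> 'a config \<Rightarrow> 'a list \<Rightarrow> 'a config \<Rightarrow> bool" for M where
  Nil: "rtm_run M c [] c"
| Cons: "rtm_step M a c c' \<Longrightarrow> rtm_run M c' w c'' \<Longrightarrow> rtm_run M c (a # w) c''"

definition rtm_init :: "('a::finite) rtm \<Rightarrow> 'a config" where
  "rtm_init M = (init M, replicate (num_tapes M) blank_tape)"

definition rtm_accepts :: "('a::finite) rtm \<Rightarrow> 'a list \<Rightarrow> bool" where
  "rtm_accepts M w \<longleftrightarrow>
     (\<exists>q ts. rtm_run M (rtm_init M) w (q, ts) \<and> q \<in> final M \<and> (\<forall>t\<in>set ts. tape_empty t))"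

definition rtm_language :: "('a::finite) rtm \<Rightarrow> 'a list set" where
  "rtm_language M = {w. rtm_accepts M w}"

end

theory Submission
  imports Defs "HOL-Library.Countable" "HOL-Library.More_List"
begin

text \<open>
  The recursion of \<open>pad\<close> lets a real-time machine guess the bits of \<open>w\<close> from left to right: after
  \<open>pad w'\<close> has been read, the next bit \<open>b\<close> takes as many letters again, plus one if \<open>b = 1\<close>, which is
  measured by a unary counter that is doubled while it is emptied.  When the last bit is guessed,
  about half of the input is left, that is, at least \<open>2 ^ (n - 2)\<close> letters for \<open>n = |w|\<close>, and this
  suffices to guess an accepting computation of length at most \<open>2 ^ n\<close> on \<open>w\<close> and to erase all tapes,
  if a constant number of steps is done per letter.

  Each tape of the simulated machine is a pair of stacks.  A bounded number of steps depends only on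
  a bounded number of top symbols of each stack.  A real-time machine therefore performs it in one
  step when it keeps the tops in its state and moves the rest to and from a tape in blocks.
\<close>

section \<open>Local relations on stacks\<close>

text \<open>Speed-up and tape compression come from one closure property: locality is preserved by
  composition, with the depths added. So boundedly many machine steps followed by one input letter
  are again a local relation, and a single construction serves for all local relations. The frame
  half of locality gives soundness, the depth half completeness. The price is that a framed relation
  cannot test a stack for emptiness. Hence the marks at the bottom of the counters and the blanks
  pushed in advance; a loading or erasing phase that stops too early is caught only by acceptance
  with empty storage. The counter has two uses. Before the last bit it measures \<open>pad\<close>;
  afterwards its units equal the letters still to come, so it is the clock that makes the simulation
  end together with the input. The last bit has to be guessed before its letters are read, since no
  input is left afterwards. At that point a word of n - 1 bits with leading 1 has been measured,
  which explains the exponent n - 2.\<close>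

type_synonym ('i, 'g) stacks = "'i \<Rightarrow> 'g list"

definition stack_append :: "('i, 'g) stacks \<Rightarrow> ('i, 'g) stacks \<Rightarrow> ('i, 'g) stacks"  (infixr \<open>\<oplus>\<close> 65)
  where "s \<oplus> r = (\<lambda>i. s i @ r i)"

abbreviation no_stacks :: "('i, 'g) stacks"  (\<open>\<emptyset>\<close>)
  where "\<emptyset> \<equiv> (\<lambda>_. [])"

lemma stack_append_apply [simp]: "(s \<oplus> r) i = s i @ r i"
  by (simp add: stack_append_def)

lemma stack_append_assoc: "(s \<oplus> r) \<oplus> t = s \<oplus> r \<oplus> t"
  by (simp add: fun_eq_iff)

lemma stack_append_empty [simp]: "s \<oplus> \<emptyset> = s" "\<emptyset> \<oplus> s = s"
  by (simp_all add: fun_eq_iff)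

type_synonym ('s, 'i, 'g) stack_rel = "'s \<times> ('i, 'g) stacks \<Rightarrow> 's \<times> ('i, 'g) stacks \<Rightarrow> bool"

text \<open>The frame property: a step stays possible when more symbols lie at the bottom of the
  stacks. Thus no step can depend on a stack being empty.\<close>

definition framed :: "('s, 'i, 'g) stack_rel \<Rightarrow> bool" where
  "framed T \<longleftrightarrow> (\<forall>q s q' s' r. T (q, s) (q', s') \<longrightarrow> T (q, s \<oplus> r) (q', s' \<oplus> r))"

text \<open>Here \<open>u\<close> is the visible part and \<open>r\<close> the hidden part. A stack
  must show \<open>K\<close> symbols or be visible down to its bottom. Of the two length bounds, the
  lower one for \<open>v\<close> keeps enough symbols visible for a second relation, and the upper
  one bounds the buffers of the machine.\<close>

definition local_rel :: "nat \<Rightarrow> ('s, 'i, 'g) stack_rel \<Rightarrow> bool" where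
  "local_rel K T \<longleftrightarrow> framed T \<and>
     (\<forall>q u r q' s'. T (q, u \<oplus> r) (q', s') \<and> (\<forall>i. r i = [] \<or> K \<le> length (u i)) \<longrightarrow>
       (\<exists>v. s' = v \<oplus> r \<and> T (q, u) (q', v) \<and>
            (\<forall>i. length (v i) \<le> length (u i) + K \<and> length (u i) \<le> length (v i) + K)))"

lemma framedD: "framed T \<Longrightarrow> T (q, s) (q', s') \<Longrightarrow> T (q, s \<oplus> r) (q', s' \<oplus> r)"
  unfolding framed_def by blast

lemma local_relE:
  assumes "local_rel K T" "T (q, u \<oplus> r) (q', s')" "\<And>i. r i = [] \<or> K \<le> length (u i)"
  obtains v where "s' = v \<oplus> r" "T (q, u) (q', v)"
    "\<And>i. length (v i) \<le> length (u i) + K" "\<And>i. length (u i) \<le> length (v i) + K"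
  using assms unfolding local_rel_def by blast

lemma local_rel_framed: "local_rel K T \<Longrightarrow> framed T"
  by (simp add: local_rel_def)

lemma local_rel_mono:
  assumes T: "local_rel K T" and "K \<le> K'"
  shows "local_rel K' T"
  unfolding local_rel_def
proof (intro conjI allI impI)
  show "framed T"
    using T by (rule local_rel_framed)
next
  fix q u r q' s'
  assume *: "T (q, u \<oplus> r) (q', s') \<and> (\<forall>i. r i = [] \<or> K' \<le> length (u i))"
  then have r: "r i = [] \<or> K \<le> length (u i)" for i
    using assms(2) by (meson order_trans)
  obtain v where v: "s' = v \<oplus> r" "T (q, u) (q', v)"
    "\<And>i. length (v i) \<le> length (u i) + K" "\<And>i. length (u i) \<le> length (v i) + K"
    by (rule local_relE[OF T conjunct1[OF *] r]) (rule that)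
  have "length (v i) \<le> length (u i) + K' \<and> length (u i) \<le> length (v i) + K'" for i
    using v(3,4)[of i] assms(2) by linarith
  with v show "\<exists>v. s' = v \<oplus> r \<and> T (q, u) (q', v) \<and>
      (\<forall>i. length (v i) \<le> length (u i) + K' \<and> length (u i) \<le> length (v i) + K')"
    by blast
qed

lemma local_rel_id: "local_rel 0 (=)"
  unfolding local_rel_def framed_def by auto

lemma framed_sup: "framed S \<Longrightarrow> framed T \<Longrightarrow> framed (sup S T)"
  unfolding framed_def by auto

lemma local_rel_sup:
  assumes "local_rel K S" "local_rel K T"
  shows "local_rel K (sup S T)"
  unfolding local_rel_def
proof (intro conjI allI impI)
  show "framed (sup S T)"
    using assms by (simp add: framed_sup local_rel_framed)
next
  fix q u r q' s'
  assume "sup S T (q, u \<oplus> r) (q', s') \<and> (\<forall>i. r i = [] \<or> K \<le> length (u i))"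
  then have T: "S (q, u \<oplus> r) (q', s') \<or> T (q, u \<oplus> r) (q', s')"
    and r: "\<And>i. r i = [] \<or> K \<le> length (u i)"
    by auto
  from T show "\<exists>v. s' = v \<oplus> r \<and> sup S T (q, u) (q', v) \<and>
            (\<forall>i. length (v i) \<le> length (u i) + K \<and> length (u i) \<le> length (v i) + K)"
  proof
    assume "S (q, u \<oplus> r) (q', s')"
    then show ?thesis by (rule local_relE[OF assms(1) _ r]) (auto simp: sup_fun_def)
  next
    assume "T (q, u \<oplus> r) (q', s')"
    then show ?thesis by (rule local_relE[OF assms(2) _ r]) (auto simp: sup_fun_def)
  qed
qed

lemma framed_comp: "framed S \<Longrightarrow> framed T \<Longrightarrow> framed (S OO T)"
  unfolding framed_def relcompp_apply split_paired_Ex by blast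

text \<open>If \<open>K + K'\<close> symbols are visible, the first relation removes at most
  \<open>K\<close> of them, so \<open>K'\<close> are left for the second.\<close>

lemma local_rel_comp:
  assumes S: "local_rel K S" and T: "local_rel K' T"
  shows "local_rel (K + K') (S OO T)"
  unfolding local_rel_def
proof (intro conjI allI impI)
  show "framed (S OO T)"
    using assms by (simp add: framed_comp local_rel_framed)
next
  fix q u r q' s'
  assume "(S OO T) (q, u \<oplus> r) (q', s') \<and> (\<forall>i. r i = [] \<or> K + K' \<le> length (u i))"
  then obtain q1 s1 where S1: "S (q, u \<oplus> r) (q1, s1)" and T1: "T (q1, s1) (q', s')"
    and r: "\<And>i. r i = [] \<or> K + K' \<le> length (u i)"
    by auto
  have r1: "r i = [] \<or> K \<le> length (u i)" for i
    using r[of i] by auto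
  obtain v where v: "s1 = v \<oplus> r" "S (q, u) (q1, v)"
    "\<And>i. length (v i) \<le> length (u i) + K" "\<And>i. length (u i) \<le> length (v i) + K"
    by (rule local_relE[OF S S1 r1]) (rule that)
  have r2: "r i = [] \<or> K' \<le> length (v i)" for i
    using r[of i] v(4)[of i] by auto
  obtain v' where v': "s' = v' \<oplus> r" "T (q1, v) (q', v')"
    "\<And>i. length (v' i) \<le> length (v i) + K'" "\<And>i. length (v i) \<le> length (v' i) + K'"
    by (rule local_relE[OF T T1[unfolded v(1)] r2]) (rule that)
  have "length (v' i) \<le> length (u i) + (K + K') \<and> length (u i) \<le> length (v' i) + (K + K')" for i
    using v(3,4)[of i] v'(3,4)[of i] by linarith
  then show "\<exists>v. s' = v \<oplus> r \<and> (S OO T) (q, u) (q', v) \<and>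
      (\<forall>i. length (v i) \<le> length (u i) + (K + K') \<and> length (u i) \<le> length (v i) + (K + K'))"
    using v(2) v' by (intro exI[of _ v']) auto
qed

lemma local_rel_relpowp: "local_rel K T \<Longrightarrow> local_rel (n * K) (T ^^ n)"
proof (induction n)
  case 0
  then show ?case by (simp add: local_rel_id)
next
  case (Suc n)
  then show ?case
    using local_rel_comp[of "n * K" "T ^^ n" K T] by (simp add: add.commute)
qed

text \<open>Idle steps as padding: a power of \<open>sup (=) R\<close> means at most that many steps
  of \<open>R\<close>.\<close>

lemma relpowp_sup_eq: "(R ^^ e) a b \<Longrightarrow> e \<le> c \<Longrightarrow> (sup (=) R ^^ c) a b"
proof (induction c arbitrary: e b)
  case 0
  then show ?case by simp
next
  case (Suc c)
  show ?case
  proof (cases "e \<le> c")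
    case True
    with Suc have "(sup (=) R ^^ c) a b"
      by blast
    then show ?thesis
      by (auto simp: sup_fun_def)
  next
    case False
    with Suc.prems have e: "e = Suc c"
      by simp
    with Suc.prems(1) obtain a' where "(R ^^ c) a a'" "R a' b"
      by auto
    with Suc.IH[of c a'] show ?thesis
      by (auto simp: sup_fun_def)
  qed
qed

section \<open>Preservation of finite state sets and alphabets\<close>

definition over :: "'i set \<Rightarrow> 'g set \<Rightarrow> ('i, 'g) stacks \<Rightarrow> bool" where
  "over I \<Gamma> s \<longleftrightarrow> (\<forall>i. set (s i) \<subseteq> \<Gamma> \<and> (i \<notin> I \<longrightarrow> s i = []))"

text \<open>The types of states and symbols may be infinite; closure under finite sets is what makes
  the real-time machine finite.\<close>

definition closed_rel :: "'s set \<Rightarrow> 'i set \<Rightarrow> 'g set \<Rightarrow> ('s, 'i, 'g) stack_rel \<Rightarrow> bool" where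
  "closed_rel Q I \<Gamma> T \<longleftrightarrow>
     (\<forall>q s q' s'. T (q, s) (q', s') \<and> q \<in> Q \<and> over I \<Gamma> s \<longrightarrow> q' \<in> Q \<and> over I \<Gamma> s')"

lemma closed_relD:
  "closed_rel Q I \<Gamma> T \<Longrightarrow> T (q, s) (q', s') \<Longrightarrow> q \<in> Q \<Longrightarrow> over I \<Gamma> s \<Longrightarrow> q' \<in> Q \<and> over I \<Gamma> s'"
  unfolding closed_rel_def by blast

lemma closed_rel_comp: "closed_rel Q I \<Gamma> S \<Longrightarrow> closed_rel Q I \<Gamma> T \<Longrightarrow> closed_rel Q I \<Gamma> (S OO T)"
  unfolding closed_rel_def relcompp_apply split_paired_Ex by blast

lemma closed_rel_sup: "closed_rel Q I \<Gamma> S \<Longrightarrow> closed_rel Q I \<Gamma> T \<Longrightarrow> closed_rel Q I \<Gamma> (sup S T)"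
  unfolding closed_rel_def sup_fun_def sup_bool_def by blast

lemma closed_rel_id: "closed_rel Q I \<Gamma> (=)"
  unfolding closed_rel_def by auto

lemma closed_rel_relpowp: "closed_rel Q I \<Gamma> T \<Longrightarrow> closed_rel Q I \<Gamma> (T ^^ n)"
  by (induction n) (auto simp: closed_rel_id intro: closed_rel_comp)


section \<open>Real-time machines for local relations\<close>

fun block_symbol :: "('g::countable) list \<Rightarrow> 'a symbol" where
  "block_symbol [] = Blank"
| "block_symbol (x # xs) = Work (to_nat (x # xs))"

lemma block_symbol_eq_Blank [simp]: "block_symbol xs = Blank \<longleftrightarrow> xs = []"
  by (cases xs) auto

lemma inj_block_symbol: "block_symbol xs = block_symbol ys \<longleftrightarrow> xs = ys"
  by (cases xs; cases ys) auto

text \<open>The stack grows to the right: the head scans the uppermost block, deeper blocks lie to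
  its left, and everything to its right is blank.\<close>

definition block_tape :: "('g::countable) list list \<Rightarrow> int \<Rightarrow> 'a tape" where
  "block_tape bs p = ((\<lambda>z. if z \<le> p then block_symbol (nth_default [] bs (nat (p - z))) else Blank), p)"

lemma read_block_tape [simp]: "read (block_tape (x # bs) p) = block_symbol x"
  by (simp add: read_def block_tape_def nth_default_def)

lemma block_tape_Nil: "block_tape [[] :: ('g::countable) list] p = block_tape ([] :: 'g list list) p"
  by (auto simp: block_tape_def nth_default_def fun_eq_iff)

lemma block_tape_empty: "tape_empty (block_tape bs p) \<longleftrightarrow> concat bs = []"
proof
  assume e: "tape_empty (block_tape bs p)"
  have "bs ! j = []" if "j < length bs" for j
    using e[unfolded tape_empty_def, rule_format, of "p - int j"] that
    by (simp add: block_tape_def nth_default_def)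
  then show "concat bs = []"
    by (auto simp: in_set_conv_nth)
next
  assume "concat bs = []"
  then show "tape_empty (block_tape bs p)"
    by (auto simp: tape_empty_def block_tape_def nth_default_def)
qed

text \<open>A left move leaves the written block on the right of the head, where only blanks are
  allowed, so it is used with \<open>y = []\<close> only. The value \<open>[[]]\<close> keeps a
  scanned block when the head moves below the bottom; by \<open>block_tape_Nil\<close> the tape is
  the same.\<close>

fun shift_blocks :: "move \<Rightarrow> 'g list \<Rightarrow> 'g list list \<Rightarrow> 'g list list" where
  "shift_blocks Stay y bs = y # bs"
| "shift_blocks Move_Right y bs = [] # y # bs"
| "shift_blocks Move_Left y bs = (if bs = [] then [[]] else bs)"

lemma act_block_tape:
  assumes "d = Move_Left \<Longrightarrow> y = []"
  shows "act (block_symbol y, d) (block_tape (x # bs) p) = block_tape (shift_blocks d y bs) (p + offset d)"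
proof (cases d)
  case Move_Left
  then have "act (block_symbol y, d) (block_tape (x # bs) p) = block_tape bs (p - 1)"
    using assms
    by (auto simp: block_tape_def nth_default_def fun_eq_iff nth_Cons' nat_diff_distrib
        Suc_nat_eq_nat_zadd1 split: if_splits)
      (auto intro!: arg_cong[of _ _ "\<lambda>n. block_symbol (bs ! n)"])
  then show ?thesis using Move_Left by (auto simp: block_tape_Nil)
next
  case Stay
  then show ?thesis
    by (auto simp: block_tape_def nth_default_def fun_eq_iff nth_Cons' split: if_splits)
next
  case Move_Right
  have "nat (p + 1 - z) = Suc (nat (p - z))" if "z \<le> p" for z
    using that by linarith
  then show ?thesis using Move_Right
    by (auto simp: block_tape_def nth_default_def fun_eq_iff nth_Cons' split: if_splits)
qed

lemma concat_shift_blocks: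
  assumes "d = Move_Left \<Longrightarrow> y = []"
  shows "concat (shift_blocks d y bs) = y @ concat bs"
  using assms by (cases d) auto

locale local_system =
  fixes K :: nat and Q :: "'s::countable set" and ix :: "'i list" and \<Gamma> :: "'g::countable set"
    and T :: "('s, 'i, 'g) stack_rel" and q0 :: 's and F :: "'s set"
  assumes finite_Q: "finite Q" and finite_\<Gamma>: "finite \<Gamma>"
    and q0: "q0 \<in> Q" and F: "F \<subseteq> Q"
    and local_T: "local_rel K T"
    and closed_T: "closed_rel Q (set ix) \<Gamma> T"
begin

definition bufs :: "nat \<Rightarrow> ('i, 'g) stacks set" where
  "bufs N = {B. over (set ix) \<Gamma> B \<and> (\<forall>i. length (B i) \<le> N)}"

text \<open>Buffers are functions and need not form a countable type, so their values along
  \<open>ix\<close> are encoded. This is injective on \<open>bufs\<close>, whose members are empty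
  outside \<open>ix\<close>.\<close>

definition code :: "'s \<Rightarrow> ('i, 'g) stacks \<Rightarrow> nat" where
  "code q B = to_nat (q, map B ix)"

text \<open>A state keeps the tops \<open>B\<close> of the stacks, the tape cells hold blocks of stack symbols, and
  blank cells count as empty blocks.  Below the scanned block nothing is read, so a step may be
  simulated on the buffers and scanned blocks alone.\<close>

definition rt_machine :: "letter rtm" where
  "rt_machine = \<lparr>num_tapes = length ix,
     states = {code q B | q B. q \<in> Q \<and> B \<in> bufs (4 * K)},
     alphabet = block_symbol ` {ys. set ys \<subseteq> \<Gamma> \<and> length ys \<le> 2 * K},
     init = code q0 \<emptyset>,
     final = {code q \<emptyset> | q. q \<in> F},
     rtm_trans = {(code q B, a, map (\<lambda>i. block_symbol (X i)) ix, code q' B',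
                   map (\<lambda>i. (block_symbol (Y i), D i)) ix) | q B a X q' B' Y D.
        q \<in> Q \<and> B \<in> bufs (4 * K) \<and> X \<in> bufs (2 * K) \<and>
        q' \<in> Q \<and> B' \<in> bufs (4 * K) \<and> Y \<in> bufs (2 * K) \<and>
        T (q, B \<oplus> X) (q', B' \<oplus> Y) \<and> (\<forall>i. D i = Move_Left \<longrightarrow> Y i = [])}\<rparr>"

lemma finite_bufs: "finite (bufs N)"
proof -
  have "bufs N \<subseteq> {B. \<forall>i. (i \<in> set ix \<longrightarrow> B i \<in> {xs. set xs \<subseteq> \<Gamma> \<and> length xs \<le> N}) \<and>
                         (i \<notin> set ix \<longrightarrow> B i = [])}"
    by (auto simp: bufs_def over_def)
  moreover have "finite \<dots>"
    by (intro finite_set_of_finite_funs finite_lists_length_le finite_\<Gamma>) simp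
  ultimately show ?thesis
    by (rule finite_subset)
qed

lemma empty_bufs: "\<emptyset> \<in> bufs N"
  by (simp add: bufs_def over_def)

lemma bufs_eqI:
  assumes "B \<in> bufs N" "B' \<in> bufs N'" "\<And>i. i \<in> set ix \<Longrightarrow> B i = B' i"
  shows "B = B'"
proof
  fix i
  show "B i = B' i"
    using assms by (cases "i \<in> set ix") (auto simp: bufs_def over_def)
qed

lemma code_eqD:
  assumes "code q B = code q' B'" "B \<in> bufs N" "B' \<in> bufs N'"
  shows "q = q'" "B = B'"
  using assms bufs_eqI[OF assms(2,3)] by (auto simp: code_def)

lemma is_rtm_rt_machine: "is_rtm rt_machine"
proof -
  have "{code q B | q B. q \<in> Q \<and> B \<in> bufs (4 * K)} = (\<lambda>(q, B). code q B) ` (Q \<times> bufs (4 * K))"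
    by auto
  then have "finite (states rt_machine)"
    by (simp add: rt_machine_def finite_Q finite_bufs)
  moreover have "finite (alphabet rt_machine)"
    by (simp add: rt_machine_def finite_lists_length_le[OF finite_\<Gamma>])
  moreover have "Blank \<in> alphabet rt_machine"
    by (auto simp: rt_machine_def intro: image_eqI[of _ _ "[]"])
  moreover have "init rt_machine \<in> states rt_machine" "final rt_machine \<subseteq> states rt_machine"
    using q0 F empty_bufs by (auto simp: rt_machine_def)
  ultimately have "machine_ok rt_machine"
    by (simp add: machine_ok_def)
  moreover have "rtm_trans rt_machine \<subseteq> states rt_machine \<times> UNIV \<times> symbol_tuples rt_machine \<times>
      states rt_machine \<times> action_tuples rt_machine"
    by (auto simp: rt_machine_def symbol_tuples_def action_tuples_def bufs_def over_def)
  ultimately show ?thesis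
    by (simp add: is_rtm_def)
qed

section \<open>Soundness of the real-time machine\<close>

definition represents :: "letter config \<Rightarrow> 's \<Rightarrow> ('i, 'g) stacks \<Rightarrow>
    ('i, 'g) stacks \<Rightarrow> ('i \<Rightarrow> 'g list list) \<Rightarrow> bool" where
  "represents c q B X W \<longleftrightarrow> B \<in> bufs (4 * K) \<and> (\<forall>i. i \<notin> set ix \<longrightarrow> X i = [] \<and> W i = []) \<and>
     (\<exists>p. c = (code q B, map (\<lambda>i. block_tape (X i # W i) (p i)) ix))"

abbreviation contents :: "('i, 'g) stacks \<Rightarrow> ('i, 'g) stacks \<Rightarrow> ('i \<Rightarrow> 'g list list) \<Rightarrow> ('i, 'g) stacks"
  where "contents B X W \<equiv> (B \<oplus> X) \<oplus> (\<lambda>i. concat (W i))"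

lemma represents_init: "represents (rtm_init rt_machine) q0 \<emptyset> \<emptyset> \<emptyset>"
proof -
  have "replicate (length ix) blank_tape = map (\<lambda>i. block_tape [[] :: 'g list] 0) ix"
    by (simp add: map_replicate_const blank_tape_def block_tape_def fun_eq_iff nth_default_def)
  then show ?thesis
    by (auto simp: represents_def empty_bufs rtm_init_def rt_machine_def)
qed

lemma act_represented:
  assumes "\<And>i. D i = Move_Left \<Longrightarrow> Y i = []"
  shows "map2 act (map (\<lambda>i. (block_symbol (Y i), D i)) ix)
           (map (\<lambda>i. block_tape (X i # W i) (p i)) ix) =
         map (\<lambda>i. block_tape (shift_blocks (D i) (Y i) (W i)) (p i + offset (D i))) ix"
  using assms by (simp add: map2_map_map act_block_tape)

text \<open>A transition certifies a step of \<open>T\<close> on the buffers and the scanned blocks;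
  the frame property adds the blocks \<open>W\<close> below. However the result is divided between
  buffer and written block, the contents are the same.\<close>

lemma rt_step_sound:
  assumes "represents c q B X W" "rtm_step rt_machine a c c'"
  shows "\<exists>q' B' X' W'. represents c' q' B' X' W' \<and> T (q, contents B X W) (q', contents B' X' W')"
proof -
  from assms(1) obtain p where c: "c = (code q B, map (\<lambda>i. block_tape (X i # W i) (p i)) ix)"
    and B: "B \<in> bufs (4 * K)" and XW: "\<And>i. i \<notin> set ix \<Longrightarrow> X i = [] \<and> W i = []"
    unfolding represents_def by blast
  from assms(2) c obtain s' as where tr: "(code q B, a, map (\<lambda>i. block_symbol (X i)) ix, s', as)
      \<in> rtm_trans rt_machine"
    and c': "c' = (s', map2 act as (map (\<lambda>i. block_tape (X i # W i) (p i)) ix))"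
    by (auto elim!: rtm_step.cases simp: comp_def)
  from tr obtain q1 B1 X1 q' B' Y D where 1: "code q B = code q1 B1"
    "map (\<lambda>i. block_symbol (X i) :: letter symbol) ix = map (\<lambda>i. block_symbol (X1 i)) ix"
    and s': "s' = code q' B'" and as: "as = map (\<lambda>i. (block_symbol (Y i), D i)) ix"
    and 2: "B1 \<in> bufs (4 * K)" "X1 \<in> bufs (2 * K)" "B' \<in> bufs (4 * K)" "Y \<in> bufs (2 * K)"
    "T (q1, B1 \<oplus> X1) (q', B' \<oplus> Y)" and D: "\<And>i. D i = Move_Left \<Longrightarrow> Y i = []"
    unfolding rt_machine_def
    by (simp only: rtm.simps mem_Collect_eq prod.inject) blast
  have "X1 i = X i" for i
    using 1(2) 2(2) XW by (cases "i \<in> set ix") (auto simp: inj_block_symbol bufs_def over_def)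
  then have "X1 = X" by auto
  with code_eqD[OF 1(1) B 2(1)] 2(5) have T: "T (q, B \<oplus> X) (q', B' \<oplus> Y)"
    by simp
  \<comment> \<open>The value \<open>[[]]\<close> outside \<open>ix\<close> makes every
    \<open>W2 i\<close> nonempty, so that head and tail are meaningful, and both are empty
    there.\<close>
  define W2 where "W2 i = (if i \<in> set ix then shift_blocks (D i) (Y i) (W i) else [[]])" for i
  define X' W' where "X' i = hd (W2 i)" and "W' i = tl (W2 i)" for i
  have ne: "W2 i \<noteq> []" for i
    by (cases "D i") (auto simp: W2_def)
  have W2: "X' i # W' i = W2 i" for i
    using ne[of i] by (simp add: X'_def W'_def)
  have "represents c' q' B' X' W'"
    unfolding represents_def
  proof (intro conjI allI impI exI)
    show "c' = (code q' B', map (\<lambda>i. block_tape (X' i # W' i) (p i + offset (D i))) ix)"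
      unfolding c' s' as W2 by (subst act_represented) (simp_all add: D W2_def)
  qed (use 2 in \<open>auto simp: X'_def W'_def W2_def\<close>)
  moreover have "contents B' X' W' = (B' \<oplus> Y) \<oplus> (\<lambda>i. concat (W i))"
  proof
    fix i
    have "X' i @ concat (W' i) = concat (W2 i)"
      by (simp flip: W2)
    also have "\<dots> = Y i @ concat (W i)"
      using D 2(4) XW by (auto simp: W2_def concat_shift_blocks bufs_def over_def)
    finally show "contents B' X' W' i = ((B' \<oplus> Y) \<oplus> (\<lambda>i. concat (W i))) i"
      by simp
  qed
  moreover have "T (q, contents B X W) (q', (B' \<oplus> Y) \<oplus> (\<lambda>i. concat (W i)))"
    using framedD[OF local_rel_framed[OF local_T] T] .
  ultimately show ?thesis
    by metis
qed

lemma rt_run_sound: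
  assumes "rtm_run rt_machine c w c'" "represents c q B X W"
  shows "\<exists>q' B' X' W'. represents c' q' B' X' W' \<and>
    (T ^^ length w) (q, contents B X W) (q', contents B' X' W')"
  using assms
proof (induction arbitrary: q B X W rule: rtm_run.induct)
  case (Nil c)
  then show ?case by auto
next
  case (Cons a c c' w c'')
  obtain q1 B1 X1 W1 where 1: "represents c' q1 B1 X1 W1" "T (q, contents B X W) (q1, contents B1 X1 W1)"
    using rt_step_sound[OF Cons.prems Cons.hyps(1)] by blast
  from Cons.IH[OF 1(1)] obtain q' B' X' W' where
    2: "represents c'' q' B' X' W'" "(T ^^ length w) (q1, contents B1 X1 W1) (q', contents B' X' W')"
    by blast
  have "(T ^^ length (a # w)) (q, contents B X W) (q', contents B' X' W')"
    using 1(2) 2(2) relpowp_Suc_I2 by (metis length_Cons)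
  with 2(1) show ?case by blast
qed

lemma rt_accepts_sound:
  assumes "rtm_accepts rt_machine w"
  shows "\<exists>q\<in>F. (T ^^ length w) (q0, \<emptyset>) (q, \<emptyset>)"
proof -
  obtain st ts where run: "rtm_run rt_machine (rtm_init rt_machine) w (st, ts)"
    and fin: "st \<in> final rt_machine" "\<forall>t\<in>set ts. tape_empty t"
    using assms unfolding rtm_accepts_def by blast
  obtain q B X W where rep: "represents (st, ts) q B X W"
    and T: "(T ^^ length w) (q0, \<emptyset>) (q, contents B X W)"
    using rt_run_sound[OF run represents_init] by auto
  from fin(1) obtain q' where q': "q' \<in> F" "st = code q' \<emptyset>"
    by (auto simp: rt_machine_def)
  from rep obtain p where p: "code q B = st" "B \<in> bufs (4 * K)"
    "\<And>i. i \<notin> set ix \<Longrightarrow> X i = [] \<and> W i = []" "ts = map (\<lambda>i. block_tape (X i # W i) (p i)) ix"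
    unfolding represents_def by blast
  have "q = q'" "B = \<emptyset>"
    using code_eqD[OF _ p(2) empty_bufs] p(1) q'(2) by auto
  moreover have "X i @ concat (W i) = []" for i
    using fin(2) p(3)[of i] unfolding p(4) by (cases "i \<in> set ix") (auto simp: block_tape_empty)
  then have "X \<oplus> (\<lambda>i. concat (W i)) = \<emptyset>"
    by (simp add: fun_eq_iff)
  ultimately show ?thesis
    using T q'(1) by (auto simp: stack_append_assoc)
qed

section \<open>Completeness of the real-time machine\<close>

text \<open>Under this invariant a step of \<open>T\<close> never has to look below the scanned block.\<close>

definition balanced :: "('i, 'g) stacks \<Rightarrow> ('i, 'g) stacks \<Rightarrow> ('i \<Rightarrow> 'g list list) \<Rightarrow> bool" where
  "balanced B X W \<longleftrightarrow> (\<forall>i. length (B i @ X i) \<le> 4 * K \<and> (W i = [] \<or> K \<le> length (B i @ X i)) \<and>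
     (\<forall>y\<in>set (X i # W i). set y \<subseteq> \<Gamma> \<and> length y \<le> 2 * K) \<and> (\<forall>y\<in>set (W i). length y = 2 * K))"

text \<open>A visible part of at least \<open>4 * K\<close> symbols gives its lowest
  \<open>2 * K\<close> to the tape as a full block, which leaves between \<open>2 * K\<close> and
  \<open>3 * K\<close>. One of fewer than \<open>K\<close> fetches a full block if there is one, and
  then has between \<open>2 * K\<close> and \<open>3 * K\<close>. Otherwise all of it stays in the
  buffer and the scanned cell becomes blank.\<close>

lemma rebalance:
  assumes "length z \<le> 5 * K" "set z \<subseteq> \<Gamma>" and W: "\<forall>y\<in>set W. set y \<subseteq> \<Gamma> \<and> length y = 2 * K"
  shows "\<exists>b y d x W'. z = b @ y \<and> (d = Move_Left \<longrightarrow> y = []) \<and> length y \<le> 2 * K \<and>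
    shift_blocks d y W = x # W' \<and> length b \<le> 4 * K \<and> length (b @ x) \<le> 4 * K \<and>
    (W' = [] \<or> K \<le> length (b @ x)) \<and>
    (\<forall>y\<in>set (x # W'). set y \<subseteq> \<Gamma> \<and> length y \<le> 2 * K) \<and> (\<forall>y\<in>set W'. length y = 2 * K)"
proof -
  consider "4 * K \<le> length z" | "length z < K" | "K \<le> length z" "length z < 4 * K"
    by linarith
  then show ?thesis
  proof cases
    case 1
    then show ?thesis
      using assms set_drop_subset[of "length z - 2 * K" z]
      by (intro exI[of _ "take (length z - 2 * K) z"] exI[of _ "drop (length z - 2 * K) z"]
          exI[of _ Move_Right] exI[of _ "[]"] exI[of _ "drop (length z - 2 * K) z # W"])
        auto
  next
    case 2
    show ?thesis
    proof (cases W)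
      case Nil
      then show ?thesis using 2
        by (intro exI[of _ z] exI[of _ "[]"] exI[of _ Move_Left]) auto
    next
      case (Cons x W')
      then show ?thesis using 2 W
        by (intro exI[of _ z] exI[of _ "[]"] exI[of _ Move_Left] exI[of _ x] exI[of _ W']) auto
    qed
  next
    case 3
    then show ?thesis using W
      by (intro exI[of _ z] exI[of _ "[]"] exI[of _ Stay] exI[of _ W]) auto
  qed
qed

text \<open>Locality confines the step to the at most \<open>4 * K\<close> visible symbols, of which
  it makes at most \<open>5 * K\<close>. The machine guesses the division given by
  \<open>rebalance\<close>, for all stacks at once.\<close>

lemma rt_step_complete:
  assumes rep: "represents c q B X W" and bal: "balanced B X W" and q: "q \<in> Q"
    and T: "T (q, contents B X W) (q', s')"
  shows "\<exists>c' B' X' W'. rtm_step rt_machine a c c' \<and> represents c' q' B' X' W' \<and> balanced B' X' W' \<and>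
     q' \<in> Q \<and> s' = contents B' X' W'"
proof -
  from rep obtain p where c: "c = (code q B, map (\<lambda>i. block_tape (X i # W i) (p i)) ix)"
    and B: "B \<in> bufs (4 * K)" and XW: "\<And>i. i \<notin> set ix \<Longrightarrow> X i = [] \<and> W i = []"
    unfolding represents_def by blast
  have r: "concat (W i) = [] \<or> K \<le> length ((B \<oplus> X) i)" for i
    using bal[unfolded balanced_def, rule_format, of i] by auto
  obtain z where z: "s' = z \<oplus> (\<lambda>i. concat (W i))" "T (q, B \<oplus> X) (q', z)"
    "\<And>i. length (z i) \<le> length ((B \<oplus> X) i) + K"
    by (rule local_relE[OF local_T T r]) (rule that)
  have X: "X \<in> bufs (2 * K)"
    using XW bal by (auto simp: bufs_def over_def balanced_def)
  have "over (set ix) \<Gamma> (B \<oplus> X)"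
    using B X by (auto simp: bufs_def over_def)
  from closed_relD[OF closed_T z(2) q this] have q': "q' \<in> Q" and oz: "over (set ix) \<Gamma> z"
    by auto
  have len: "length (z i) \<le> 5 * K" for i
    using z(3)[of i] bal[unfolded balanced_def, rule_format, of i] by simp
  have "\<forall>i. \<exists>b y d x W'. z i = b @ y \<and> (d = Move_Left \<longrightarrow> y = []) \<and> length y \<le> 2 * K \<and>
    shift_blocks d y (W i) = x # W' \<and> length b \<le> 4 * K \<and> length (b @ x) \<le> 4 * K \<and>
    (W' = [] \<or> K \<le> length (b @ x)) \<and>
    (\<forall>y\<in>set (x # W'). set y \<subseteq> \<Gamma> \<and> length y \<le> 2 * K) \<and> (\<forall>y\<in>set W'. length y = 2 * K)"
    by (intro allI rebalance len) (use oz bal in \<open>auto simp: over_def balanced_def\<close>)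
  then obtain B1 Y D X1 W1 where *: "\<And>i. z i = B1 i @ Y i" "\<And>i. D i = Move_Left \<Longrightarrow> Y i = []"
    "\<And>i. length (Y i) \<le> 2 * K" "\<And>i. shift_blocks (D i) (Y i) (W i) = X1 i # W1 i"
    "\<And>i. length (B1 i) \<le> 4 * K"
    "\<And>i. length (B1 i @ X1 i) \<le> 4 * K \<and> (W1 i = [] \<or> K \<le> length (B1 i @ X1 i)) \<and>
      (\<forall>y\<in>set (X1 i # W1 i). set y \<subseteq> \<Gamma> \<and> length y \<le> 2 * K) \<and> (\<forall>y\<in>set (W1 i). length y = 2 * K)"
    unfolding choice_iff by blast
  define X' W' where "X' i = (if i \<in> set ix then X1 i else [])"
    and "W' i = (if i \<in> set ix then W1 i else [])" for i
  have BY: "B1 \<in> bufs (4 * K)" "Y \<in> bufs (2 * K)"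
    using oz *(1,3,5) by (auto simp: bufs_def over_def)
  have zeq: "z = B1 \<oplus> Y"
    using *(1) by auto
  define c' where "c' = (code q' B1, map2 act (map (\<lambda>i. (block_symbol (Y i), D i)) ix) (snd c))"
  have "(code q B, a, map read (snd c), code q' B1, map (\<lambda>i. (block_symbol (Y i), D i)) ix) \<in> rtm_trans rt_machine"
  proof -
    have "map read (snd c) = map (\<lambda>i. block_symbol (X i)) ix"
      by (simp add: c comp_def)
    then show ?thesis
      using q q' B X BY z(2) *(2) unfolding zeq rt_machine_def
      by (simp only: rtm.simps mem_Collect_eq prod.inject) blast
  qed
  then have "rtm_step rt_machine a c c'"
    unfolding c'_def c by (auto intro: rtm_step.intros)
  moreover have "c' = (code q' B1, map (\<lambda>i. block_tape (X' i # W' i) (p i + offset (D i))) ix)"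
    unfolding c'_def c snd_conv by (subst act_represented) (simp_all add: *(2,4) X'_def W'_def)
  then have "represents c' q' B1 X' W'"
    using BY unfolding represents_def by (auto simp: X'_def W'_def)
  moreover have "balanced B1 X' W'"
    unfolding balanced_def
  proof
    fix i
    show "length (B1 i @ X' i) \<le> 4 * K \<and> (W' i = [] \<or> K \<le> length (B1 i @ X' i)) \<and>
     (\<forall>y\<in>set (X' i # W' i). set y \<subseteq> \<Gamma> \<and> length y \<le> 2 * K) \<and> (\<forall>y\<in>set (W' i). length y = 2 * K)"
      using *(5)[of i] *(6)[of i] by (cases "i \<in> set ix") (simp_all add: X'_def W'_def)
  qed
  moreover have "s' = contents B1 X' W'"
  proof
    fix i
    have "X1 i @ concat (W1 i) = Y i @ concat (W i)"
      using concat_shift_blocks[of "D i" "Y i" "W i"] *(2,4)[of i] by simp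
    then show "s' i = contents B1 X' W' i"
      using XW BY by (auto simp: z(1) zeq X'_def W'_def bufs_def over_def)
  qed
  ultimately show ?thesis
    using q' by blast
qed

lemma rt_run_complete:
  assumes "(T ^^ n) (q, contents B X W) (q', s')" "represents c q B X W" "balanced B X W" "q \<in> Q"
  shows "\<exists>c' B' X' W'. rtm_run rt_machine c (replicate n a) c' \<and> represents c' q' B' X' W' \<and>
    s' = contents B' X' W'"
  using assms
proof (induction n arbitrary: c q B X W)
  case 0
  then have "q' = q" "s' = contents B X W"
    by auto
  with 0 show ?case
    by (metis replicate_0 rtm_run.Nil)
next
  case (Suc n)
  obtain q1 s1 where T1: "T (q, contents B X W) (q1, s1)" "(T ^^ n) (q1, s1) (q', s')"
    using Suc.prems(1) by (metis relpowp_Suc_D2 surj_pair)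
  obtain c1 B1 X1 W1 where 1: "rtm_step rt_machine a c c1" "represents c1 q1 B1 X1 W1"
    "balanced B1 X1 W1" "q1 \<in> Q" "s1 = contents B1 X1 W1"
    using rt_step_complete[OF Suc.prems(2-4) T1(1)] by blast
  from Suc.IH[OF T1(2)[unfolded 1(5)] 1(2-4)] show ?case
    using rtm_run.Cons[OF 1(1)] unfolding replicate_Suc by blast
qed

lemma rt_accepts_complete:
  assumes "q \<in> F" "(T ^^ n) (q0, \<emptyset>) (q, \<emptyset>)"
  shows "rtm_accepts rt_machine (replicate n a)"
proof -
  have bal: "balanced \<emptyset> \<emptyset> \<emptyset>"
    by (simp add: balanced_def)
  have "(T ^^ n) (q0, contents \<emptyset> \<emptyset> \<emptyset>) (q, \<emptyset>)"
    using assms(2) by simp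
  from rt_run_complete[OF this represents_init bal q0, of a]
  obtain c B X W where run: "rtm_run rt_machine (rtm_init rt_machine) (replicate n a) c"
    and rep: "represents c q B X W" and e: "\<emptyset> = contents B X W"
    by blast
  have e: "B i = [] \<and> X i = [] \<and> concat (W i) = []" for i
    using fun_cong[OF e, of i] by simp
  then have "B = \<emptyset>"
    by auto
  with rep obtain p where "c = (code q \<emptyset>, map (\<lambda>i. block_tape (X i # W i) (p i)) ix)"
    unfolding represents_def by blast
  moreover have "code q \<emptyset> \<in> final rt_machine"
    using assms(1) by (auto simp: rt_machine_def)
  moreover have "tape_empty (block_tape (X i # W i) (p i) :: letter tape)" for i
    using e[of i] by (simp add: block_tape_empty)
  ultimately show ?thesis
    using run unfolding rtm_accepts_def
    by (intro exI[of _ "code q \<emptyset>"] exI[of _ "snd c"]) auto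
qed

theorem rt_language: "rtm_language rt_machine = {replicate n Letter_a | n. \<exists>q\<in>F. (T ^^ n) (q0, \<emptyset>) (q, \<emptyset>)}"
proof -
  have w: "w = replicate (length w) Letter_a" for w
    by (intro replicate_eqI) (auto intro: letter.exhaust)
  show ?thesis
    unfolding rtm_language_def using rt_accepts_sound rt_accepts_complete w by blast
qed

end

section \<open>Rewriting the tops of stacks\<close>

type_synonym ('s, 'i, 'g) rules = "'s \<Rightarrow> ('i, 'g) stacks \<Rightarrow> 's \<Rightarrow> ('i, 'g) stacks \<Rightarrow> bool"

inductive rewrite :: "('s, 'i, 'g) rules \<Rightarrow> ('s, 'i, 'g) stack_rel" for R where
  "R q u q' v \<Longrightarrow> rewrite R (q, u \<oplus> r) (q', v \<oplus> r)"

lemma rewriteI: "R q u q' v \<Longrightarrow> s = u \<oplus> r \<Longrightarrow> s' = v \<oplus> r \<Longrightarrow> rewrite R (q, s) (q', s')"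
  using rewrite.intros[of R q u q' v r] by simp

lemma framed_rewrite: "framed (rewrite R)"
  unfolding framed_def
  by (auto elim!: rewrite.cases simp: stack_append_assoc intro: rewrite.intros)

text \<open>The replaced top has at most \<open>K\<close> symbols. Where something is hidden,
  \<open>K\<close> symbols are visible and contain it; elsewhere the visible part is the whole
  stack.\<close>

lemma local_rel_rewrite:
  assumes R: "\<And>q u q' v i. R q u q' v \<Longrightarrow> length (u i) \<le> K \<and> length (v i) \<le> K"
  shows "local_rel K (rewrite R)"
  unfolding local_rel_def
proof (intro conjI allI impI framed_rewrite)
  fix q u r q' s'
  assume *: "rewrite R (q, u \<oplus> r) (q', s') \<and> (\<forall>i. r i = [] \<or> K \<le> length (u i))"
  then obtain u1 v1 r1 where R1: "R q u1 q' v1" and eq: "u \<oplus> r = u1 \<oplus> r1" and s': "s' = v1 \<oplus> r1"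
    by (auto elim: rewrite.cases)
  define r2 where "r2 i = drop (length (u1 i)) (u i)" for i
  have 1: "u i = u1 i @ r2 i \<and> r1 i = r2 i @ r i" for i
  proof -
    have "r i = [] \<or> length (u1 i) \<le> length (u i)"
      using * R[OF R1, of i] by (meson order_trans)
    moreover have e: "u i @ r i = u1 i @ r1 i"
      using fun_cong[OF eq, of i] by simp
    ultimately have "length (u1 i) \<le> length (u i)"
      by (metis append_Nil2 length_append le_add1)
    with e have "u1 i = take (length (u1 i)) (u i)"
      by (metis append_eq_append_conv_if append_eq_conv_conj nle_le take_all)
    with e show ?thesis
      unfolding r2_def by (metis append.assoc append_take_drop_id same_append_eq)
  qed
  then have 2: "u = u1 \<oplus> r2" "r1 = r2 \<oplus> r"
    by auto
  show "\<exists>v. s' = v \<oplus> r \<and> rewrite R (q, u) (q', v) \<and>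
          (\<forall>i. length (v i) \<le> length (u i) + K \<and> length (u i) \<le> length (v i) + K)"
    using R[OF R1] R1 unfolding s' 2
    by (intro exI[of _ "v1 \<oplus> r2"]) (auto simp: stack_append_assoc trans_le_add2 intro: rewrite.intros)
qed

lemma closed_rel_rewrite:
  assumes R: "\<And>q u q' v. R q u q' v \<Longrightarrow> q \<in> Q \<Longrightarrow>
    q' \<in> Q \<and> (\<forall>i. set (v i) \<subseteq> \<Gamma> \<union> (\<Union>j. set (u j)) \<and> (i \<notin> I \<longrightarrow> v i = []))"
  shows "closed_rel Q I \<Gamma> (rewrite R)"
  unfolding closed_rel_def
proof (intro allI impI)
  fix q s q' s'
  assume *: "rewrite R (q, s) (q', s') \<and> q \<in> Q \<and> over I \<Gamma> s"
  then obtain u v r where "R q u q' v" "s = u \<oplus> r" "s' = v \<oplus> r"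
    by (auto elim: rewrite.cases)
  with * R[of q u q' v] show "q' \<in> Q \<and> over I \<Gamma> s'"
    by (auto simp: over_def) blast
qed


section \<open>Tapes as pairs of stacks\<close>

text \<open>The right stack starts with the scanned cell.  Cells beyond the bottom of a stack are blank.\<close>

definition tape_split :: "'a symbol list \<Rightarrow> 'a symbol list \<Rightarrow> 'a tape \<Rightarrow> bool" where
  "tape_split l r t \<longleftrightarrow> (\<forall>n. fst t (snd t + int n) = nth_default Blank r n) \<and>
     (\<forall>n. fst t (snd t - 1 - int n) = nth_default Blank l n)"

text \<open>A simulated step pops the scanned cell and its left neighbour \<open>y\<close> whatever
  the move is, so all three moves share one left-hand side. \<open>new_left\<close> and
  \<open>new_right\<close> are pushed in return.\<close>

fun new_left :: "'a action \<Rightarrow> 'a symbol \<Rightarrow> 'a symbol list" where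
  "new_left (a, Move_Left) y = []"
| "new_left (a, Stay) y = [y]"
| "new_left (a, Move_Right) y = [a, y]"

fun new_right :: "'a action \<Rightarrow> 'a symbol \<Rightarrow> 'a symbol list" where
  "new_right (a, Move_Left) y = [y, a]"
| "new_right (a, Stay) y = [a]"
| "new_right (a, Move_Right) y = []"

lemma read_tape_split: "tape_split l (x # r) t \<Longrightarrow> read t = x"
  by (auto simp: tape_split_def read_def dest: spec[of _ 0])

lemma act_tape_split:
  assumes "tape_split (y # l) (x # r) t"
  shows "tape_split (new_left a y @ l) (new_right a y @ r) (act a t)"
proof -
  obtain f p where t: "t = (f, p)"
    by (cases t)
  obtain b d where a: "a = (b, d)"
    by (cases a)
  have R: "f (p + int n) = nth_default Blank (x # r) n"
    and L: "f (p - 1 - int n) = nth_default Blank (y # l) n" for n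
    using assms by (auto simp: tape_split_def t)
  show ?thesis
  proof (cases d)
    case Move_Left
    have "(f(p := b)) (p - 1 + int n) = nth_default Blank (y # b # r) n" for n
    proof (cases n)
      case 0
      then show ?thesis using L[of 0] by simp
    next
      case (Suc m)
      then show ?thesis using R[of m] by (cases m) (auto simp: algebra_simps)
    qed
    moreover have "(f(p := b)) (p - 1 - 1 - int n) = nth_default Blank l n" for n
      using L[of "Suc n"] by (simp add: algebra_simps)
    ultimately show ?thesis
      by (simp add: tape_split_def t a Move_Left)
  next
    case Stay
    have "(f(p := b)) (p + int n) = nth_default Blank (b # r) n" for n
      using R[of n] by (cases n) auto
    moreover have "(f(p := b)) (p - 1 - int n) = nth_default Blank (y # l) n" for n
      using L[of n] by simp
    ultimately show ?thesis
      by (simp add: tape_split_def t a Stay)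
  next
    case Move_Right
    have "(f(p := b)) (p + 1 + int n) = nth_default Blank r n" for n
      using R[of "Suc n"] by (simp add: algebra_simps)
    moreover have "(f(p := b)) (p + 1 - 1 - int n) = nth_default Blank (b # y # l) n" for n
      using L[of "n - 1"] by (cases n) (auto simp: algebra_simps)
    ultimately show ?thesis
      by (simp add: tape_split_def t a Move_Right)
  qed
qed

lemma blank_tape_eq: "blank_tape = input_tape []"
  by (auto simp: blank_tape_def input_tape_def)

lemma tape_split_blank: "tape_split [] [] blank_tape"
  by (simp add: tape_split_def blank_tape_def)

text \<open>This makes \<open>silent_blank\<close> harmless: any number of blanks on either side
  represents the same blank tape.\<close>

lemma tape_split_blank_push:
  assumes "tape_split l r blank_tape"
  shows "tape_split (Blank # l) r blank_tape" "tape_split l (Blank # r) blank_tape"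
proof -
  have *: "nth_default Blank l n = Blank" "nth_default Blank r n = Blank" for n
    using assms by (simp_all add: tape_split_def blank_tape_def)
  have "nth_default Blank (Blank # l) n = Blank" "nth_default Blank (Blank # r) n = Blank" for n
    by (cases n; simp add: *)+
  then show "tape_split (Blank # l) r blank_tape" "tape_split l (Blank # r) blank_tape"
    by (simp_all add: * tape_split_def blank_tape_def)
qed

text \<open>The word is loaded from its last bit backwards. The head remains on the first cell while
  the part already present shifts to the right.\<close>

lemma tape_split_input_push:
  assumes "tape_split l r (input_tape w)"
  shows "tape_split l (Input b # r) (input_tape (b # w))"
proof -
  have *: "nth_default Blank r n = (if n < length w then Input (w ! n) else Blank)"
    "nth_default Blank l n = Blank" for n
    using assms[unfolded tape_split_def, THEN conjunct1, rule_format, of n]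
      assms[unfolded tape_split_def, THEN conjunct2, rule_format, of n]
    by (auto simp: input_tape_def)
  have "nth_default Blank (Input b # r) n = (if n < length (b # w) then Input ((b # w) ! n) else Blank)" for n
    by (cases n) (auto simp: *)
  then show ?thesis
    by (auto simp: tape_split_def input_tape_def *)
qed


section \<open>The guessing system\<close>

instance bit :: countable by countable_datatype
instance symbol :: (countable) countable by countable_datatype

datatype index = Cnt bool | Inp | Lft nat | Rgt nat

text \<open>\<open>Mark\<close> lies at the bottom of each counter and replaces the test for
  emptiness; \<open>Cell\<close> wraps the tape symbols of the simulated machine.\<close>

datatype cell = Mark | Unit | Bit bit | Cell "bit symbol"

instance cell :: countable by countable_datatype

datatype phase = Start | Count bool | Fill | Load | Run nat | Clean

instance phase :: countable by countable_datatype

section \<open>Lengths of padded strings\<close>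

lemma length_pad_snoc: "length (pad (w @ [b])) = 2 * length (pad w) + of_bool (b = One)"
  by (cases b) (simp_all add: pad_snoc_Zero pad_snoc_One)

lemma length_pad_One: "length (pad [One]) = 1"
  by (simp add: pad_One)

text \<open>The leading bit alone contributes this much. It is the source of the time available to
  the simulation.\<close>

lemma pad_ge: "2 ^ length v \<le> length (pad (One # v))"
proof (induction v rule: rev_induct)
  case Nil
  then show ?case by (simp add: length_pad_One)
next
  case (snoc b v)
  then show ?case
    using length_pad_snoc[of "One # v" b] by simp
qed

locale simulation =
  fixes M :: "bit ntm"
  assumes is_ntm: "is_ntm M"
begin

abbreviation "d \<equiv> num_tapes M"

text \<open>The guard \<open>j < d\<close> makes equality of such stacks a question about the tapes
  of \<open>M\<close> only.\<close>

definition on_tapes :: "(nat \<Rightarrow> bit symbol list) \<Rightarrow> (nat \<Rightarrow> bit symbol list) \<Rightarrow> (index, cell) stacks" where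
  "on_tapes l r i = (case i of Lft j \<Rightarrow> if j < d then map Cell (l j) else []
     | Rgt j \<Rightarrow> if j < d then map Cell (r j) else [] | _ \<Rightarrow> [])"

lemma on_tapes_simps [simp]:
  "on_tapes l r (Cnt x) = []" "on_tapes l r Inp = []"
  "on_tapes l r (Lft j) = (if j < d then map Cell (l j) else [])"
  "on_tapes l r (Rgt j) = (if j < d then map Cell (r j) else [])"
  by (simp_all add: on_tapes_def)

lemma on_tapes_append: "on_tapes l r \<oplus> on_tapes l' r' = on_tapes (\<lambda>j. l j @ l' j) (\<lambda>j. r j @ r' j)"
  by (auto simp: fun_eq_iff on_tapes_def split: index.splits)

definition tape_indices :: "index set" where
  "tape_indices = Lft ` {..<d} \<union> Rgt ` {..<d}"

definition indices :: "index list" where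
  "indices = Cnt False # Cnt True # Inp # map Lft [0..<d] @ map Rgt [0..<d]"

text \<open>Each tick consumes one input letter.  Following the recursion of \<open>pad\<close>, the stacks
  \<open>Cnt x\<close> and \<open>Cnt (\<not> x)\<close> take turns: while one is emptied, the other receives two units per
  letter.  The bits of \<open>w\<close> are guessed and pushed on \<open>Inp\<close>.  The last bit is guessed at the
  beginning of its turn, and the rest of the input is measured by popping the remaining units.\<close>

inductive tick :: "(phase, index, cell) rules" where
  tick_start: "tick Start \<emptyset> (Count False) (\<emptyset>(Cnt False := [Unit, Mark], Cnt True := [Mark], Inp := [Bit One]))"
| tick_short: "[One] \<in> ntm_language M \<Longrightarrow> tick Start \<emptyset> Clean \<emptyset>"
| tick_work: "tick (Count x) (\<emptyset>(Cnt x := [Unit])) (Count x) (\<emptyset>(Cnt (\<not> x) := [Unit, Unit]))"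
| tick_zero: "tick (Count x) (\<emptyset>(Cnt x := [Unit, Mark]))
    (Count (\<not> x)) (\<emptyset>(Cnt x := [Mark], Cnt (\<not> x) := [Unit, Unit], Inp := [Bit Zero]))"
| tick_one: "tick (Count x) (\<emptyset>(Cnt x := [Mark]))
    (Count (\<not> x)) (\<emptyset>(Cnt x := [Mark], Cnt (\<not> x) := [Unit], Inp := [Bit One]))"
| tick_last: "\<sigma> \<in> {Fill, Load, Clean} \<union> range Run \<Longrightarrow> u = [Unit] \<or> u = [Unit, Mark] \<Longrightarrow>
    tick \<sigma> (\<emptyset>(Cnt x := u)) \<sigma> \<emptyset>"

text \<open>These rules do not consume input.  No stack is ever tested for emptiness: enough blanks
  are pushed in advance, and a part of the guessed word that is not loaded remains on \<open>Inp\<close>.\<close>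

inductive silent :: "(phase, index, cell) rules" where
  silent_enter: "silent (Count x) (\<emptyset>(Cnt (\<not> x) := [Mark]))
    Fill (\<emptyset>(Cnt x := (if b = One then [Unit] else []), Inp := [Bit b]))"
| silent_blank: "i \<in> tape_indices \<Longrightarrow> silent Fill \<emptyset> Fill (\<emptyset>(i := [Cell Blank]))"
| silent_filled: "silent Fill \<emptyset> Load \<emptyset>"
| silent_load: "silent Load (\<emptyset>(Inp := [Bit b])) Load (\<emptyset>(Rgt 0 := [Cell (Input b)]))"
| silent_loaded: "silent Load \<emptyset> (Run (init M)) \<emptyset>"
| silent_run: "(q, xs, q', as) \<in> ntm_trans M \<Longrightarrow>
    silent (Run q) (on_tapes (\<lambda>j. [y j]) (\<lambda>j. [xs ! j]))
      (Run q') (on_tapes (\<lambda>j. new_left (as ! j) (y j)) (\<lambda>j. new_right (as ! j) (y j)))"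
| silent_halt: "q \<in> final M \<Longrightarrow> silent (Run q) \<emptyset> Clean \<emptyset>"
| silent_pop: "i \<in> tape_indices \<Longrightarrow> silent Clean (\<emptyset>(i := [g])) Clean \<emptyset>"

text \<open>At most \<open>c\<close> silent steps and then exactly one letter, so the number of
  chunks is the length of the input.\<close>

definition chunk :: "nat \<Rightarrow> (phase, index, cell) stack_rel" where
  "chunk c = (sup (=) (rewrite silent) ^^ c) OO rewrite tick"

definition phases :: "phase set" where
  "phases = {Start, Count False, Count True, Fill, Load, Clean} \<union> Run ` states M"

definition cells :: "cell set" where
  "cells = {Mark, Unit, Bit Zero, Bit One} \<union> Cell ` alphabet M"

section \<open>Locality and closure of the chunks\<close>

lemma d_pos: "0 < d"
  using is_ntm by (auto simp: is_ntm_def)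

lemma tick_length: "tick q u q' v \<Longrightarrow> length (u i) \<le> 2 \<and> length (v i) \<le> 2"
  by (induction rule: tick.induct) auto

lemma length_new: "length (new_left a y) \<le> 2" "length (new_right a y) \<le> 2"
  by (cases a; cases "snd a"; simp)+

lemma silent_length: "silent q u q' v \<Longrightarrow> length (u i) \<le> 2 \<and> length (v i) \<le> 2"
  by (induction rule: silent.induct)
    (auto simp: on_tapes_def length_new split: index.splits)

lemma local_silents: "local_rel (2 * c) (sup (=) (rewrite silent) ^^ c)"
proof -
  have "local_rel 2 (rewrite silent)"
    by (rule local_rel_rewrite, rule silent_length)
  moreover have "local_rel 2 (=)"
    by (rule local_rel_mono[OF local_rel_id]) simp
  ultimately show ?thesis
    using local_rel_relpowp[OF local_rel_sup] by (metis mult.commute)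
qed

lemmas framed_silents = local_rel_framed[OF local_silents]

lemma local_chunk: "local_rel (2 * c + 2) (chunk c)"
  unfolding chunk_def
  by (rule local_rel_comp[OF local_silents], rule local_rel_rewrite, rule tick_length)

lemma tick_closed:
  assumes "tick q u q' v" "q \<in> phases"
  shows "q' \<in> phases \<and> (\<forall>i. set (v i) \<subseteq> cells \<union> (\<Union>j. set (u j)) \<and> (i \<notin> set indices \<longrightarrow> v i = []))"
  using assms
  by (induction rule: tick.induct) (auto simp: phases_def cells_def indices_def)

lemma set_new: "set (new_left a y) \<union> set (new_right a y) \<subseteq> {fst a, y}"
  by (cases a; cases "snd a"; auto)

lemma silent_closed:
  assumes "silent q u q' v" "q \<in> phases"
  shows "q' \<in> phases \<and> (\<forall>i. set (v i) \<subseteq> cells \<union> (\<Union>j. set (u j)) \<and> (i \<notin> set indices \<longrightarrow> v i = []))"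
  using assms
proof (induction rule: silent.induct)
  case (silent_enter x b)
  then show ?case
    by (cases b) (auto simp: phases_def cells_def indices_def)
next
  case (silent_blank i)
  then show ?case
    using is_ntm by (auto simp: phases_def cells_def indices_def tape_indices_def is_ntm_def machine_ok_def)
next
  case silent_filled
  then show ?case by (auto simp: phases_def)
next
  case (silent_load b)
  then show ?case
    using is_ntm d_pos by (auto simp: phases_def cells_def indices_def is_ntm_def)
next
  case silent_loaded
  then show ?case
    using is_ntm by (auto simp: phases_def is_ntm_def machine_ok_def)
next
  case (silent_run q xs q' as y)
  have q': "q' \<in> states M" and as: "as \<in> action_tuples M"
    using is_ntm silent_run by (auto simp: is_ntm_def)
  have "fst (as ! j) \<in> alphabet M" if "j < d" for j
  proof -
    have "as ! j \<in> alphabet M \<times> UNIV"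
      using as that nth_mem[of j as] by (auto simp: action_tuples_def)
    then show ?thesis by auto
  qed
  \<comment> \<open>The neighbour \<open>y j\<close> is unrestricted in the rule. It need not belong
    to \<open>cells\<close>, but it is among the popped symbols, which closure allows to be pushed
    again.\<close>
  moreover have "Cell (y j) \<in> (\<Union>i. set (on_tapes (\<lambda>j. [y j]) (\<lambda>j. [xs ! j]) i))" if "j < d" for j
    using that by (auto intro!: exI[of _ "Lft j"])
  ultimately have "Cell ` {fst (as ! j), y j} \<subseteq> cells \<union> (\<Union>i. set (on_tapes (\<lambda>j. [y j]) (\<lambda>j. [xs ! j]) i))"
    if "j < d" for j
    using that by (auto simp: cells_def)
  then have "Cell ` (set (new_left (as ! j) (y j)) \<union> set (new_right (as ! j) (y j)))
      \<subseteq> cells \<union> (\<Union>i. set (on_tapes (\<lambda>j. [y j]) (\<lambda>j. [xs ! j]) i))" if "j < d" for j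
    using that by (intro subset_trans[OF image_mono[OF set_new]])
  then have "set (on_tapes (\<lambda>j. new_left (as ! j) (y j)) (\<lambda>j. new_right (as ! j) (y j)) i)
      \<subseteq> cells \<union> (\<Union>i. set (on_tapes (\<lambda>j. [y j]) (\<lambda>j. [xs ! j]) i))" for i
    by (cases i) auto
  moreover have "on_tapes l r i = []" if "i \<notin> set indices" for i l r
    using that by (cases i) (auto simp: indices_def)
  ultimately show ?case
    using q' by (auto simp: phases_def)
next
  case (silent_halt q)
  then show ?case by (auto simp: phases_def)
next
  case (silent_pop i g)
  then show ?case by (auto simp: phases_def)
qed

lemma closed_chunk: "closed_rel phases (set indices) cells (chunk c)"
proof -
  have "closed_rel phases (set indices) cells (rewrite tick)"
    by (rule closed_rel_rewrite, rule tick_closed)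
  moreover have "closed_rel phases (set indices) cells (rewrite silent)"
    by (rule closed_rel_rewrite, rule silent_closed)
  ultimately show ?thesis
    unfolding chunk_def by (intro closed_rel_comp closed_rel_relpowp closed_rel_sup closed_rel_id)
qed

lemma local_system_chunk: "local_system (2 * c + 2) phases indices cells (chunk c) Start {Clean}"
proof
  show "finite phases" "finite cells"
    using is_ntm by (auto simp: phases_def cells_def is_ntm_def machine_ok_def)
  show "Start \<in> phases" "{Clean} \<subseteq> phases"
    by (auto simp: phases_def)
  show "local_rel (2 * c + 2) (chunk c)"
    by (rule local_chunk)
  show "closed_rel phases (set indices) cells (chunk c)"
    by (rule closed_chunk)
qed

subsection \<open>Soundness\<close>

definition units :: "(index, cell) stacks \<Rightarrow> nat" where
  "units s = count_list (s (Cnt False)) Unit + count_list (s (Cnt True)) Unit"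

text \<open>The turn that follows \<open>w\<close>, with \<open>i\<close> units left: each letter
  read in it has moved one unit and doubled it. \<open>Inp\<close> has the newest bit on
  top.\<close>

definition counting :: "bool \<Rightarrow> bit list \<Rightarrow> nat \<Rightarrow> (index, cell) stacks" where
  "counting x w i = \<emptyset>(Cnt x := replicate i Unit @ [Mark],
     Cnt (\<not> x) := replicate (2 * (length (pad w) - i)) Unit @ [Mark], Inp := map Bit (rev w))"

text \<open>The units are exactly the letters still to come. The guessed word is
  \<open>v @ w\<close>, of which the suffix \<open>w\<close> has been loaded.\<close>

definition simulating :: "nat \<Rightarrow> (index, cell) stacks \<Rightarrow> bit list \<Rightarrow> bit list \<Rightarrow> bool" where
  "simulating n s v w \<longleftrightarrow> n + units s = length (pad (v @ w)) \<and> s Inp = map Bit (rev v)"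

definition holds_tapes :: "(index, cell) stacks \<Rightarrow> bit tape list \<Rightarrow> bool" where
  "holds_tapes s ts \<longleftrightarrow> length ts = d \<and>
     (\<forall>j<d. \<exists>l r. s (Lft j) = map Cell l \<and> s (Rgt j) = map Cell r \<and> tape_split l r (ts ! j))"

text \<open>Here \<open>n\<close> is the number of letters read. With p for
  \<open>length (pad w)\<close>, the turn in \<open>Count x\<close> began after p letters and p - i
  of its letters are gone, so n = 2 * p - i. In \<open>Clean\<close> the tapes are forgotten, since
  acceptance is already established.\<close>

fun inv :: "nat \<Rightarrow> phase \<Rightarrow> (index, cell) stacks \<Rightarrow> bool" where
  "inv n Start s \<longleftrightarrow> n = 0 \<and> s = \<emptyset>"
| "inv n (Count x) s \<longleftrightarrow>
     (\<exists>w i. i \<le> length (pad w) \<and> s = counting x w i \<and> n + i = 2 * length (pad w))"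
| "inv n Fill s \<longleftrightarrow> (\<exists>v. simulating n s v [] \<and> holds_tapes s (snd (ntm_init M [])))"
| "inv n Load s \<longleftrightarrow> (\<exists>v w. simulating n s v w \<and> holds_tapes s (snd (ntm_init M w)))"
| "inv n (Run q) s \<longleftrightarrow> (\<exists>v w t ts. simulating n s v w \<and>
     (ntm_step M ^^ t) (ntm_init M w) (q, ts) \<and> holds_tapes s ts)"
| "inv n Clean s \<longleftrightarrow> (\<exists>v w. simulating n s v w \<and> w \<in> ntm_language M)"

lemma holds_tapes_cong:
  "(\<And>j. s (Lft j) = s' (Lft j)) \<Longrightarrow> (\<And>j. s (Rgt j) = s' (Rgt j)) \<Longrightarrow> holds_tapes s ts = holds_tapes s' ts"
  by (simp add: holds_tapes_def)

lemma simulating_cong: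
  "(\<And>x. s (Cnt x) = s' (Cnt x)) \<Longrightarrow> s Inp = s' Inp \<Longrightarrow> simulating n s v w = simulating n s' v w"
  by (simp add: simulating_def units_def)

text \<open>Stated relative to \<open>x\<close> because the counters are named \<open>Cnt x\<close>
  and \<open>Cnt (\<not> x)\<close> with \<open>x\<close> unknown.\<close>

lemma index_eqI:
  assumes "s (Cnt x) = s' (Cnt x)" "s (Cnt (\<not> x)) = s' (Cnt (\<not> x))" "s Inp = s' Inp"
    "\<And>j. s (Lft j) = s' (Lft j)" "\<And>j. s (Rgt j) = s' (Rgt j)"
  shows "s = (s' :: (index, cell) stacks)"
proof
  fix i
  show "s i = s' i"
  proof (cases i)
    case (Cnt y)
    then show ?thesis
      using assms(1,2) by (cases "y = x") auto
  qed (use assms in auto)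
qed

lemma counting_simps [simp]:
  "counting x w i (Cnt x) = replicate i Unit @ [Mark]"
  "counting x w i (Cnt (\<not> x)) = replicate (2 * (length (pad w) - i)) Unit @ [Mark]"
  "counting x w i Inp = map Bit (rev w)"
  "counting x w i (Lft j) = []" "counting x w i (Rgt j) = []"
  "counting (\<not> x) w i (Cnt x) = replicate (2 * (length (pad w) - i)) Unit @ [Mark]"
  by (auto simp: counting_def)

lemma inv_tick:
  assumes "inv n q s" "rewrite tick (q, s) (q', s')"
  shows "inv (Suc n) q' s'"
proof -
  from assms(2) obtain u v r where tick: "tick q u q' v" and s: "s = u \<oplus> r" and s': "s' = v \<oplus> r"
    by (auto elim: rewrite.cases)
  from tick show ?thesis
  proof cases
    case tick_start
    then have "r = \<emptyset>"
      using assms(1) s by simp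
    then have "s' = counting False [One] 1"
      unfolding s' tick_start
      by (intro index_eqI[of _ False]) (simp_all add: length_pad_One counting_def)
    then show ?thesis
      using assms(1) tick_start by (auto simp: length_pad_One intro!: exI[of _ "[One]"] exI[of _ 1])
  next
    case tick_short
    then have "simulating (Suc n) s' [] [One]"
      using assms(1) s s' by (simp add: simulating_def units_def length_pad_One)
    then show ?thesis
      using tick_short by auto
  next
    case (tick_work x)
    then obtain w i where i: "i \<le> length (pad w)" "n + i = 2 * length (pad w)"
      and e: "u \<oplus> r = counting x w i"
      using assms(1) s by auto
    have e: "u j @ r j = counting x w i j" for j
      using fun_cong[OF e, of j] by simp
    have "Unit # r (Cnt x) = replicate i Unit @ [Mark]"
      using e[of "Cnt x"] tick_work by simp
    then obtain k where k: "i = Suc k" "r (Cnt x) = replicate k Unit @ [Mark]"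
      by (cases i) auto
    have "2 * (length (pad w) - k) = Suc (Suc (2 * (length (pad w) - i)))"
      using i k by simp
    then have "s' = counting x w k"
      using e[of "Cnt (\<not> x)"] e[of Inp] e[of "Lft _"] e[of "Rgt _"] k
      unfolding s' tick_work by (intro index_eqI[of _ x]) simp_all
    then show ?thesis
      using i k tick_work by (auto intro!: exI[of _ w] exI[of _ k])
  next
    case (tick_zero x)
    then obtain w i where i: "i \<le> length (pad w)" "n + i = 2 * length (pad w)"
      and e: "u \<oplus> r = counting x w i"
      using assms(1) s by auto
    have e: "u j @ r j = counting x w i j" for j
      using fun_cong[OF e, of j] by simp
    have "Unit # Mark # r (Cnt x) = replicate i Unit @ [Mark]"
      using e[of "Cnt x"] tick_zero by simp
    \<comment> \<open>The mark below shows that this is the last unit, so the present letter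
      completes the turn of a \<open>Zero\<close>.\<close>
    then have k: "i = 1" "r (Cnt x) = []"
      by (cases i; cases "i - 1"; auto)+
    have "2 * length (pad w) = Suc (Suc (2 * (length (pad w) - i)))"
      using i k by simp
    then have "s' = counting (\<not> x) (w @ [Zero]) (2 * length (pad w))"
      using e[of "Cnt (\<not> x)"] e[of Inp] e[of "Lft _"] e[of "Rgt _"] k
      unfolding s' tick_zero by (intro index_eqI[of _ x]) (simp_all add: length_pad_snoc)
    then show ?thesis
      using i k tick_zero
      by (auto simp: length_pad_snoc intro!: exI[of _ "w @ [Zero]"] exI[of _ "2 * length (pad w)"])
  next
    case (tick_one x)
    then obtain w i where i: "i \<le> length (pad w)" "n + i = 2 * length (pad w)"
      and e: "u \<oplus> r = counting x w i"
      using assms(1) s by auto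
    have e: "u j @ r j = counting x w i j" for j
      using fun_cong[OF e, of j] by simp
    have "Mark # r (Cnt x) = replicate i Unit @ [Mark]"
      using e[of "Cnt x"] tick_one by simp
    \<comment> \<open>All units are spent, so the present letter is the additional one of a
      \<open>One\<close>.\<close>
    then have k: "i = 0" "r (Cnt x) = []"
      by (cases i; auto)+
    then have "s' = counting (\<not> x) (w @ [One]) (Suc (2 * length (pad w)))"
      using e[of "Cnt (\<not> x)"] e[of Inp] e[of "Lft _"] e[of "Rgt _"] k
      unfolding s' tick_one by (intro index_eqI[of _ x]) (simp_all add: length_pad_snoc)
    then show ?thesis
      using i k tick_one
      by (auto simp: length_pad_snoc intro!: exI[of _ "w @ [One]"] exI[of _ "Suc (2 * length (pad w))"])
  next
    case (tick_last us x)
    have "units s = Suc (units s')"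
      using tick_last unfolding s s' by (cases x) (auto simp: units_def)
    moreover have "s Inp = s' Inp"
      using tick_last unfolding s s' by auto
    ultimately have "simulating n s v w \<Longrightarrow> simulating (Suc n) s' v w" for v w
      by (simp add: simulating_def)
    moreover have "holds_tapes s ts = holds_tapes s' ts" for ts
      by (rule holds_tapes_cong) (use tick_last in \<open>auto simp: s s'\<close>)
    ultimately show ?thesis
      using assms(1) tick_last by auto blast+
  qed
qed

lemma nth_ntm_init: "j < d \<Longrightarrow> snd (ntm_init M w) ! j = input_tape (if j = 0 then w else [])"
  by (cases j) (auto simp: ntm_init_def blank_tape_eq)

lemma length_ntm_init: "length (snd (ntm_init M w)) = d"
  using d_pos by (simp add: ntm_init_def)

lemma inv_silent:
  assumes "inv n q s" "rewrite silent (q, s) (q', s')"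
  shows "inv n q' s'"
proof -
  from assms(2) obtain u v r where silent: "silent q u q' v" and s: "s = u \<oplus> r" and s': "s' = v \<oplus> r"
    by (auto elim: rewrite.cases)
  from silent show ?thesis
  proof cases
    case (silent_enter x b)
    then obtain w i where i: "i \<le> length (pad w)" "n + i = 2 * length (pad w)"
      and e: "u \<oplus> r = counting x w i"
      using assms(1) s by auto
    have e: "u j @ r j = counting x w i j" for j
      using fun_cong[OF e, of j] by simp
    have "Mark # r (Cnt (\<not> x)) = replicate (2 * (length (pad w) - i)) Unit @ [Mark]"
      using e[of "Cnt (\<not> x)"] silent_enter by simp
    \<comment> \<open>A bare mark on the receiving counter shows that no letter of this turn has
      been read.\<close>
    then have k: "2 * (length (pad w) - i) = 0" "r (Cnt (\<not> x)) = []"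
      by (cases "2 * (length (pad w) - i)"; auto)+
    have "count_list (replicate i Unit) Unit = i" for i
      by (induction i) auto
    \<comment> \<open>Now \<open>n\<close> and \<open>i\<close> both equal
      \<open>length (pad w)\<close>. With the additional unit for \<open>One\<close>, the units are
      what \<open>pad (w @ [b])\<close> still requires.\<close>
    then have "units s' = i + of_bool (b = One)"
      using e[of "Cnt x"] k silent_enter unfolding s' by (cases x) (auto simp: units_def)
    then have "simulating n s' (w @ [b]) []"
      using e[of Inp] i k silent_enter by (auto simp: simulating_def length_pad_snoc s')
    moreover have "holds_tapes s' (snd (ntm_init M []))"
      using e[of "Lft _"] e[of "Rgt _"] silent_enter tape_split_blank
      by (auto simp: holds_tapes_def length_ntm_init nth_ntm_init s' simp flip: blank_tape_eq)
    ultimately show ?thesis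
      using silent_enter by auto
  next
    case (silent_blank i)
    then obtain w where w: "simulating n s w []" and t: "holds_tapes s (snd (ntm_init M []))"
      using assms(1) by auto
    have "simulating n s' w []"
      using w by (subst simulating_cong[of _ s]) (use silent_blank in \<open>auto simp: s s' tape_indices_def\<close>)
    moreover have "holds_tapes s' (snd (ntm_init M []))"
      unfolding holds_tapes_def
    proof (intro conjI allI impI length_ntm_init)
      fix j assume j: "j < d"
      then obtain l r where lr: "s (Lft j) = map Cell l" "s (Rgt j) = map Cell r" "tape_split l r blank_tape"
        using t by (auto simp: holds_tapes_def nth_ntm_init blank_tape_eq)
      show "\<exists>l r. s' (Lft j) = map Cell l \<and> s' (Rgt j) = map Cell r \<and> tape_split l r (snd (ntm_init M []) ! j)"
        using lr tape_split_blank_push[OF lr(3)] j silent_blank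
        by (cases i)
          (auto simp: s s' nth_ntm_init tape_indices_def simp flip: blank_tape_eq list.map(2)
            intro: exI[of _ l] exI[of _ r] exI[of _ "Blank # l"] exI[of _ "Blank # r"])
    qed
    ultimately show ?thesis
      using silent_blank by auto
  next
    case silent_filled
    then show ?thesis
      using assms(1) s s' by auto
  next
    case (silent_load b)
    then obtain v1 w where w: "simulating n s v1 w" and t: "holds_tapes s (snd (ntm_init M w))"
      using assms(1) by auto
    have "s Inp = Bit b # r Inp"
      using silent_load s by simp
    \<comment> \<open>The top of \<open>Inp\<close> is the last bit not yet loaded; moving it to the
      front of \<open>w\<close> does not change the guessed word.\<close>
    with w obtain v2 where v2: "v1 = v2 @ [b]" "r Inp = map Bit (rev v2)"
      by (cases v1 rule: rev_cases) (auto simp: simulating_def)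
    have "simulating n s' v2 (b # w)"
      using w v2 silent_load by (auto simp: s s' simulating_def units_def)
    moreover have "holds_tapes s' (snd (ntm_init M (b # w)))"
      unfolding holds_tapes_def
    proof (intro conjI allI impI length_ntm_init)
      fix j assume j: "j < d"
      then obtain l r where lr: "s (Lft j) = map Cell l" "s (Rgt j) = map Cell r"
        "tape_split l r (input_tape (if j = 0 then w else []))"
        using t by (auto simp: holds_tapes_def nth_ntm_init)
      show "\<exists>l r. s' (Lft j) = map Cell l \<and> s' (Rgt j) = map Cell r \<and> tape_split l r (snd (ntm_init M (b # w)) ! j)"
        using lr tape_split_input_push[of l r w b] j silent_load
        by (intro exI[of _ l] exI[of _ "if j = 0 then Input b # r else r"]) (auto simp: s s' nth_ntm_init)
    qed
    ultimately show ?thesis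
      using silent_load by auto
  next
    case silent_loaded
    then obtain v1 w where w: "simulating n s v1 w" and t: "holds_tapes s (snd (ntm_init M w))"
      using assms(1) by auto
    have "(ntm_step M ^^ 0) (ntm_init M w) (init M, snd (ntm_init M w))"
      by (simp add: ntm_init_def)
    with w t show ?thesis
      using silent_loaded s s' by (simp del: relpowp.simps) blast
  next
    case (silent_run q1 xs q2 as y)
    then obtain v1 w t ts where w: "simulating n s v1 w" and t: "(ntm_step M ^^ t) (ntm_init M w) (q1, ts)"
      and ts: "holds_tapes s ts"
      using assms(1) by auto
    have len: "length xs = d" "length as = d" "length ts = d"
      using silent_run(5) ts is_ntm
      by (auto simp: is_ntm_def symbol_tuples_def action_tuples_def holds_tapes_def)
    have tape: "\<exists>l r'. r (Lft j) = map Cell l \<and> r (Rgt j) = map Cell r' \<and> tape_split (y j # l) (xs ! j # r') (ts ! j)"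
      if "j < d" for j
    proof -
      obtain l r' where lr: "s (Lft j) = map Cell l" "s (Rgt j) = map Cell r'" "tape_split l r' (ts ! j)"
        using ts \<open>j < d\<close> unfolding holds_tapes_def by blast
      then have "map Cell l = Cell (y j) # r (Lft j)" "map Cell r' = Cell (xs ! j) # r (Rgt j)"
        using \<open>j < d\<close> silent_run by (auto simp: s)
      then show ?thesis
        using lr(3) by (auto simp: map_eq_Cons_conv) metis
    qed
    have "map read ts = xs"
      using tape len by (intro nth_equalityI) (auto dest: read_tape_split)
    then have "ntm_step M (q1, ts) (q2, map2 act as ts)"
      using silent_run(5) by (auto intro: ntm_step.intros)
    with t have "(ntm_step M ^^ Suc t) (ntm_init M w) (q2, map2 act as ts)"
      by auto
    moreover have "holds_tapes s' (map2 act as ts)"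
      unfolding holds_tapes_def
    proof (intro conjI allI impI)
      fix j assume j: "j < d"
      obtain l r' where lr: "r (Lft j) = map Cell l" "r (Rgt j) = map Cell r'"
        "tape_split (y j # l) (xs ! j # r') (ts ! j)"
        using tape[OF j] by blast
      show "\<exists>l r. s' (Lft j) = map Cell l \<and> s' (Rgt j) = map Cell r \<and> tape_split l r (map2 act as ts ! j)"
        using lr(1,2) j len act_tape_split[OF lr(3), of "as ! j"] silent_run(4)
        by - (rule exI[of _ "new_left (as ! j) (y j) @ l"],
            rule exI[of _ "new_right (as ! j) (y j) @ r'"], simp add: s')
    qed (use len in simp)
    moreover have "simulating n s' v1 w"
      using w by (subst simulating_cong[of _ s]) (use silent_run in \<open>auto simp: s s'\<close>)
    ultimately show ?thesis
      using silent_run(3) by (simp del: relpowp.simps) blast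
  next
    case (silent_halt q1)
    then have "s' = s"
      using s s' by simp
    with silent_halt assms(1) show ?thesis
      by (fastforce simp: ntm_language_def ntm_accepts_in_def)
  next
    case (silent_pop i g)
    then have "simulating n s' v w = simulating n s v w" for v w
      by (intro simulating_cong) (auto simp: s s' tape_indices_def)
    with silent_pop assms(1) show ?thesis
      by simp
  qed
qed

lemma inv_chunk:
  assumes "inv n q s" "chunk c (q, s) (q', s')"
  shows "inv (Suc n) q' s'"
proof -
  obtain q1 s1 where 1: "(sup (=) (rewrite silent) ^^ c) (q, s) (q1, s1)" "rewrite tick (q1, s1) (q', s')"
    using assms(2) unfolding chunk_def by auto
  from 1(1) have "inv n q1 s1"
  proof (induction c arbitrary: q1 s1)
    case 0
    then show ?case using assms(1) by simp
  next
    case (Suc c)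
    then obtain q2 s2 where "(sup (=) (rewrite silent) ^^ c) (q, s) (q2, s2)"
      "(q2, s2) = (q1, s1) \<or> rewrite silent (q2, s2) (q1, s1)"
      by (auto simp: sup_fun_def)
    then show ?case
      using Suc.IH inv_silent by blast
  qed
  then show ?thesis
    using inv_tick 1(2) by blast
qed

text \<open>In \<open>Clean\<close>, an empty \<open>Inp\<close> means that the whole guessed word
  was loaded, and empty counters mean that exactly its padded length was read.\<close>

lemma chunks_sound:
  assumes "(chunk c ^^ n) (Start, \<emptyset>) (Clean, \<emptyset>)"
  shows "\<exists>w\<in>ntm_language M. n = length (pad w)"
proof -
  have "(chunk c ^^ n) (Start, \<emptyset>) (q, s) \<Longrightarrow> inv n q s" for q s
    by (induction n arbitrary: q s) (auto intro: inv_chunk)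
  then have "inv n Clean \<emptyset>"
    using assms by blast
  then show ?thesis
    by (auto simp: simulating_def units_def)
qed

subsection \<open>Completeness\<close>

lemmas tickI = rewriteI[where R = tick]
lemmas silentI = rewriteI[where R = silent]

section \<open>Counting through all bits but the last\<close>

lemma count_work:
  "k \<le> i \<Longrightarrow> i \<le> length (pad w) \<Longrightarrow>
    (rewrite tick ^^ k) (Count x, counting x w i) (Count x, counting x w (i - k))"
proof (induction k)
  case 0
  then show ?case by simp
next
  case (Suc k)
  define r where "r = (counting x w i)(Cnt x := replicate (i - Suc k) Unit @ [Mark],
    Cnt (\<not> x) := replicate (2 * (length (pad w) - (i - k))) Unit @ [Mark])"
  have 1: "i - k = Suc (i - Suc k)"
    "2 * (length (pad w) - (i - Suc k)) = Suc (Suc (2 * (length (pad w) - (i - k))))"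
    using Suc.prems by auto
  have "rewrite tick (Count x, counting x w (i - k)) (Count x, counting x w (i - Suc k))"
  proof (rule tickI[OF tick_work])
    show "counting x w (i - k) = \<emptyset>(Cnt x := [Unit]) \<oplus> r"
      by (rule index_eqI[of _ x]) (simp_all add: r_def 1(1))
    show "counting x w (i - Suc k) = \<emptyset>(Cnt (\<not> x) := [Unit, Unit]) \<oplus> r"
      by (rule index_eqI[of _ x]) (simp_all add: r_def 1(2))
  qed
  with Suc show ?case
    by auto
qed

text \<open>The turn of a bit takes as many ticks as were made before it, plus one for
  \<open>One\<close>. Which counter is active depends on the parity of the number of turns, hence
  the existential.\<close>

lemma count_complete:
  "\<exists>x. (rewrite tick ^^ length (pad (One # v))) (Start, \<emptyset>)
         (Count x, counting x (One # v) (length (pad (One # v))))"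
proof (induction v rule: rev_induct)
  case Nil
  have "counting False [One] 1 = \<emptyset>(Cnt False := [Unit, Mark], Cnt True := [Mark], Inp := [Bit One])"
    by (rule index_eqI[of _ False]) (simp_all add: counting_def length_pad_One)
  then have "rewrite tick (Start, \<emptyset>) (Count False, counting False [One] 1)"
    by (intro tickI[OF tick_start, of _ \<emptyset>]) auto
  then show ?case
    by (auto simp: length_pad_One)
next
  case (snoc b v)
  define p where "p = length (pad (One # v))"
  have p: "0 < p"
    using pad_ge[of v] by (auto simp: p_def intro: less_le_trans)
  obtain x where x: "(rewrite tick ^^ p) (Start, \<emptyset>) (Count x, counting x (One # v) p)"
    using snoc unfolding p_def by blast
  have len: "length (pad (One # v @ [b])) = 2 * p + of_bool (b = One)"
    using length_pad_snoc[of "One # v" b] by (simp add: p_def)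
  have "(rewrite tick ^^ (p + of_bool (b = One))) (Count x, counting x (One # v) p)
      (Count (\<not> x), counting (\<not> x) (One # v @ [b]) (length (pad (One # v @ [b]))))"
  proof (cases b)
    case Zero
    have "rewrite tick (Count x, counting x (One # v) 1)
      (Count (\<not> x), counting (\<not> x) (One # v @ [b]) (length (pad (One # v @ [b]))))"
    proof (rule tickI[OF tick_zero])
      let ?r = "\<emptyset>(Cnt (\<not> x) := replicate (2 * (p - 1)) Unit @ [Mark], Inp := map Bit (rev (One # v)))"
      show "counting x (One # v) 1 = \<emptyset>(Cnt x := [Unit, Mark]) \<oplus> ?r"
        by (rule index_eqI[of _ x]) (simp_all add: p_def)
      have "2 * p = Suc (Suc (2 * (p - 1)))"
        using p by simp
      then show "counting (\<not> x) (One # v @ [b]) (length (pad (One # v @ [b]))) =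
          \<emptyset>(Cnt x := [Mark], Cnt (\<not> x) := [Unit, Unit], Inp := [Bit Zero]) \<oplus> ?r"
        by (intro index_eqI[of _ x]) (simp_all add: Zero len[unfolded Zero])
    qed
    moreover have "(rewrite tick ^^ (p - 1)) (Count x, counting x (One # v) p) (Count x, counting x (One # v) 1)"
      using count_work[of "p - 1" p "One # v" x, folded p_def] p by (simp add: Suc_leI)
    ultimately have "(rewrite tick ^^ Suc (p - 1)) (Count x, counting x (One # v) p)
      (Count (\<not> x), counting (\<not> x) (One # v @ [b]) (length (pad (One # v @ [b]))))"
      by (rule relpowp_Suc_I[rotated])
    then show ?thesis
      using p Zero by (simp del: relpowp.simps)
  next
    case One
    have "rewrite tick (Count x, counting x (One # v) 0)
      (Count (\<not> x), counting (\<not> x) (One # v @ [b]) (length (pad (One # v @ [b]))))"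
    proof (rule tickI[OF tick_one])
      let ?r = "\<emptyset>(Cnt (\<not> x) := replicate (2 * p) Unit @ [Mark], Inp := map Bit (rev (One # v)))"
      show "counting x (One # v) 0 = \<emptyset>(Cnt x := [Mark]) \<oplus> ?r"
        by (rule index_eqI[of _ x]) (simp_all add: p_def)
      show "counting (\<not> x) (One # v @ [b]) (length (pad (One # v @ [b]))) =
          \<emptyset>(Cnt x := [Mark], Cnt (\<not> x) := [Unit], Inp := [Bit One]) \<oplus> ?r"
        by (intro index_eqI[of _ x]) (simp_all add: One len[unfolded One])
    qed
    moreover have "(rewrite tick ^^ p) (Count x, counting x (One # v) p) (Count x, counting x (One # v) 0)"
      using count_work[of p p "One # v" x] by (simp add: p_def)
    ultimately have "(rewrite tick ^^ Suc p) (Count x, counting x (One # v) p)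
      (Count (\<not> x), counting (\<not> x) (One # v @ [b]) (length (pad (One # v @ [b]))))"
      by (rule relpowp_Suc_I[rotated])
    then show ?thesis
      using One by (simp del: relpowp.simps)
  qed
  with x have "(rewrite tick ^^ (p + (p + of_bool (b = One)))) (Start, \<emptyset>)
      (Count (\<not> x), counting (\<not> x) (One # v @ [b]) (length (pad (One # v @ [b]))))"
    unfolding relpowp_add by blast
  moreover have "p + (p + of_bool (b = One)) = length (pad (One # v @ [b]))"
    by (simp add: len)
  ultimately show ?case
    by (metis append_Cons)
qed

section \<open>Filling, loading, running and erasing\<close>

lemma fill_one: "i \<in> tape_indices \<Longrightarrow>
  (rewrite silent ^^ N) (Fill, s) (Fill, \<emptyset>(i := replicate N (Cell Blank)) \<oplus> s)"
proof (induction N)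
  case 0
  then show ?case by (simp add: fun_eq_iff)
next
  case (Suc N)
  have "rewrite silent (Fill, \<emptyset>(i := replicate N (Cell Blank)) \<oplus> s)
      (Fill, \<emptyset>(i := replicate (Suc N) (Cell Blank)) \<oplus> s)"
    by (rule silentI[OF silent_blank[OF Suc.prems], of _ "\<emptyset>(i := replicate N (Cell Blank)) \<oplus> s"])
      (auto simp: fun_eq_iff)
  from relpowp_Suc_I[OF Suc.IH[OF Suc.prems] this] show ?case .
qed

lemma fill_complete:
  "(rewrite silent ^^ (card tape_indices * N)) (Fill, s)
     (Fill, on_tapes (\<lambda>_. replicate N Blank) (\<lambda>_. replicate N Blank) \<oplus> s)"
proof -
  \<comment> \<open>Generalized to subsets, so that the stacks are filled one after the other by
    induction.\<close>
  have "(rewrite silent ^^ (card A * N)) (Fill, s)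
      (Fill, (\<lambda>i. if i \<in> A then replicate N (Cell Blank) else []) \<oplus> s)"
    if "finite A" "A \<subseteq> tape_indices" for A
    using that
  proof (induction A rule: finite_induct)
    case empty
    then show ?case by simp
  next
    case (insert i A)
    have eq: "(\<lambda>j. if j \<in> insert i A then replicate N (Cell Blank) else []) \<oplus> s =
      \<emptyset>(i := replicate N (Cell Blank)) \<oplus> (\<lambda>i. if i \<in> A then replicate N (Cell Blank) else []) \<oplus> s"
      using insert by (auto simp: fun_eq_iff)
    have "i \<in> tape_indices" "A \<subseteq> tape_indices"
      using insert.prems by auto
    note insert.IH[OF this(2)]
      fill_one[OF this(1), of N "(\<lambda>i. if i \<in> A then replicate N (Cell Blank) else []) \<oplus> s"]
    then have "(rewrite silent ^^ (card A * N + N)) (Fill, s)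
      (Fill, (\<lambda>j. if j \<in> insert i A then replicate N (Cell Blank) else []) \<oplus> s)"
      unfolding relpowp_add eq by (rule relcomppI)
    moreover have "card (insert i A) * N = card A * N + N"
      using insert by simp
    ultimately show ?case
      by (simp only:)
  qed
  moreover have "on_tapes (\<lambda>_. replicate N Blank) (\<lambda>_. replicate N Blank) =
      (\<lambda>i. if i \<in> tape_indices then replicate N (Cell Blank) else [])"
    by (auto simp: fun_eq_iff on_tapes_def tape_indices_def split: index.splits)
  moreover have "finite tape_indices"
    by (simp add: tape_indices_def)
  ultimately show ?thesis
    by simp
qed

lemma load_complete:
  "(rewrite silent ^^ length w) (Load, on_tapes l r \<oplus> \<emptyset>(Inp := map Bit (rev w)))
     (Load, on_tapes l (r(0 := map Input w @ r 0)))"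
proof (induction w arbitrary: r rule: rev_induct)
  case Nil
  then show ?case by (simp add: fun_eq_iff)
next
  case (snoc b w)
  have "rewrite silent (Load, on_tapes l r \<oplus> \<emptyset>(Inp := map Bit (rev (w @ [b]))))
     (Load, on_tapes l (r(0 := Input b # r 0)) \<oplus> \<emptyset>(Inp := map Bit (rev w)))"
  proof (rule silentI[OF silent_load])
    show "on_tapes l r \<oplus> \<emptyset>(Inp := map Bit (rev (w @ [b]))) =
        \<emptyset>(Inp := [Bit b]) \<oplus> on_tapes l r \<oplus> \<emptyset>(Inp := map Bit (rev w))"
      by (rule index_eqI[of _ False]) auto
    show "on_tapes l (r(0 := Input b # r 0)) \<oplus> \<emptyset>(Inp := map Bit (rev w)) =
        \<emptyset>(Rgt 0 := [Cell (Input b)]) \<oplus> on_tapes l r \<oplus> \<emptyset>(Inp := map Bit (rev w))"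
      using d_pos by (intro index_eqI[of _ False]) auto
  qed
  from relpowp_Suc_I2[OF this snoc[of "r(0 := Input b # r 0)"]] show ?case
    by (simp only: length_append_singleton map_append append.assoc list.map append_Cons append_Nil
        fun_upd_same fun_upd_upd)
qed

text \<open>Both length bounds matter: a stack loses at most one cell per step, so the reserve of
  blanks lasts, and it gains at most one, so erasing stays cheap.\<close>

lemma run_step_complete:
  assumes "ntm_step M (q, ts) (q', ts')" "length ts = d"
    and split: "\<And>j. j < d \<Longrightarrow> tape_split (l j) (r j) (ts ! j) \<and> l j \<noteq> [] \<and> r j \<noteq> []"
  shows "\<exists>l' r'. rewrite silent (Run q, on_tapes l r) (Run q', on_tapes l' r') \<and> length ts' = d \<and>
    (\<forall>j<d. tape_split (l' j) (r' j) (ts' ! j) \<and>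
       length (l' j) \<le> Suc (length (l j)) \<and> length (l j) \<le> Suc (length (l' j)) \<and>
       length (r' j) \<le> Suc (length (r j)) \<and> length (r j) \<le> Suc (length (r' j)))"
proof -
  from assms(1) obtain as where tr: "(q, map read ts, q', as) \<in> ntm_trans M"
    and ts': "ts' = map2 act as ts"
    by (auto elim: ntm_step.cases)
  have len: "length as = d"
    using tr is_ntm by (auto simp: is_ntm_def action_tuples_def)
  define y where "y j = hd (l j)" for j
  define l' r' where "l' j = new_left (as ! j) (y j) @ tl (l j)"
    and "r' j = new_right (as ! j) (y j) @ tl (r j)" for j
  have l: "l j = y j # tl (l j)" and r: "r j = map read ts ! j # tl (r j)" if "j < d" for j
  proof -
    show "l j = y j # tl (l j)"
      using split[OF that] by (simp add: y_def)
    show "r j = map read ts ! j # tl (r j)"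
      using split[OF that] read_tape_split[of "l j" "hd (r j)" "tl (r j)" "ts ! j"] that assms(2) by simp
  qed
  have "rewrite silent (Run q, on_tapes l r) (Run q', on_tapes l' r')"
  proof (rule silentI[OF silent_run[OF tr]])
    show "on_tapes l r = on_tapes (\<lambda>j. [y j]) (\<lambda>j. [map read ts ! j]) \<oplus> on_tapes (\<lambda>j. tl (l j)) (\<lambda>j. tl (r j))"
      unfolding on_tapes_append using l r by (intro index_eqI[of _ False]) auto
    show "on_tapes l' r' = on_tapes (\<lambda>j. new_left (as ! j) (y j)) (\<lambda>j. new_right (as ! j) (y j)) \<oplus>
        on_tapes (\<lambda>j. tl (l j)) (\<lambda>j. tl (r j))"
      unfolding on_tapes_append l'_def r'_def ..
  qed
  moreover have "tape_split (l' j) (r' j) (ts' ! j)" if "j < d" for j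
    using act_tape_split[of "y j" "tl (l j)" "map read ts ! j" "tl (r j)" "ts ! j" "as ! j"]
      split[OF that] l[OF that] r[OF that] that len assms(2)
    by (simp add: ts' l'_def r'_def)
  moreover have "length (l' j) \<le> Suc (length (l j)) \<and> length (l j) \<le> Suc (length (l' j)) \<and>
       length (r' j) \<le> Suc (length (r j)) \<and> length (r j) \<le> Suc (length (r' j))" if "j < d" for j
    using length_new[where a = "as ! j" and y = "y j"]
      arg_cong[OF l[OF that], of length] arg_cong[OF r[OF that], of length]
    by (simp add: l'_def r'_def del: length_tl)
  moreover have "length ts' = d"
    using len assms(2) by (simp add: ts')
  ultimately show ?thesis
    by blast
qed

lemma run_complete:
  assumes "(ntm_step M ^^ t) (q, ts) (q', ts')" "length ts = d"
    and "\<And>j. j < d \<Longrightarrow> tape_split (l j) (r j) (ts ! j) \<and> t \<le> length (l j) \<and> t \<le> length (r j)"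
  shows "\<exists>l' r'. (rewrite silent ^^ t) (Run q, on_tapes l r) (Run q', on_tapes l' r') \<and>
    (\<forall>j<d. length (l' j) \<le> length (l j) + t \<and> length (r' j) \<le> length (r j) + t)"
  using assms
proof (induction t arbitrary: q ts l r)
  case 0
  then show ?case by auto
next
  case (Suc t)
  obtain q1 ts1 where 1: "ntm_step M (q, ts) (q1, ts1)" "(ntm_step M ^^ t) (q1, ts1) (q', ts')"
    using relpowp_Suc_D2[OF Suc.prems(1)] by auto
  have "tape_split (l j) (r j) (ts ! j) \<and> l j \<noteq> [] \<and> r j \<noteq> []" if "j < d" for j
    using Suc.prems(3)[OF that] by auto
  from run_step_complete[OF 1(1) Suc.prems(2) this]
  obtain l1 r1 where 2: "rewrite silent (Run q, on_tapes l r) (Run q1, on_tapes l1 r1)" "length ts1 = d"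
    "\<And>j. j < d \<Longrightarrow> tape_split (l1 j) (r1 j) (ts1 ! j) \<and>
       length (l1 j) \<le> Suc (length (l j)) \<and> length (l j) \<le> Suc (length (l1 j)) \<and>
       length (r1 j) \<le> Suc (length (r j)) \<and> length (r j) \<le> Suc (length (r1 j))"
    by metis
  have "tape_split (l1 j) (r1 j) (ts1 ! j) \<and> t \<le> length (l1 j) \<and> t \<le> length (r1 j)" if "j < d" for j
    using 2(3)[OF that] Suc.prems(3)[OF that] by linarith
  from Suc.IH[OF 1(2) 2(2) this] obtain l' r' where
    3: "(rewrite silent ^^ t) (Run q1, on_tapes l1 r1) (Run q', on_tapes l' r')"
    "\<forall>j<d. length (l' j) \<le> length (l1 j) + t \<and> length (r' j) \<le> length (r1 j) + t"
    by blast
  have "length (l' j) \<le> length (l j) + Suc t \<and> length (r' j) \<le> length (r j) + Suc t" if "j < d" for j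
    using 2(3)[OF that] 3(2) that by (metis (no_types, lifting) add_Suc_shift add_le_mono1 add_Suc order_trans)
  with relpowp_Suc_I2[OF 2(1) 3(1)] show ?case
    by blast
qed

lemma clean_one: "i \<in> tape_indices \<Longrightarrow>
  (rewrite silent ^^ length xs) (Clean, \<emptyset>(i := xs) \<oplus> s) (Clean, s)"
proof (induction xs)
  case Nil
  then show ?case by (simp add: fun_eq_iff)
next
  case (Cons g xs)
  have "rewrite silent (Clean, \<emptyset>(i := g # xs) \<oplus> s) (Clean, \<emptyset>(i := xs) \<oplus> s)"
    by (rule silentI[OF silent_pop[OF Cons.prems, of g], of _ "\<emptyset>(i := xs) \<oplus> s"]) (auto simp: fun_eq_iff)
  with Cons show ?case
    by (simp only: list.size) (metis add.commute plus_1_eq_Suc add_0 relpowp_Suc_I2)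
qed

lemma clean_complete:
  assumes "finite A" "A \<subseteq> tape_indices" "\<And>i. i \<notin> A \<Longrightarrow> s i = []"
  shows "(rewrite silent ^^ (\<Sum>i\<in>A. length (s i))) (Clean, s) (Clean, \<emptyset>)"
  using assms
proof (induction A arbitrary: s rule: finite_induct)
  case empty
  then show ?case by (simp add: fun_eq_iff)
next
  case (insert i A)
  have "(rewrite silent ^^ (\<Sum>j\<in>A. length ((s(i := [])) j))) (Clean, s(i := [])) (Clean, \<emptyset>)"
    using insert by (intro insert.IH) auto
  moreover have "(\<Sum>j\<in>A. length ((s(i := [])) j)) = (\<Sum>j\<in>A. length (s j))"
    using insert by (intro sum.cong) auto
  moreover have "(rewrite silent ^^ length (s i)) (Clean, s) (Clean, s(i := []))"
  proof -
    have "s = \<emptyset>(i := s i) \<oplus> s(i := [])"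
      by (simp add: fun_eq_iff)
    then show ?thesis
      using clean_one[of i "s i" "s(i := [])"] insert by simp
  qed
  ultimately have "(rewrite silent ^^ (length (s i) + (\<Sum>j\<in>A. length (s j)))) (Clean, s) (Clean, \<emptyset>)"
    unfolding relpowp_add by auto
  then show ?case
    using insert by simp
qed

text \<open>With P for \<open>2 ^ length w\<close>, filling costs at most 2 * d * P steps. Each of
  the at most 2 * d stacks ends with at most 3 * P cells, so erasing costs at most 6 * d * P.
  Loading, running and the three phase changes add at most 5 * P. The bound leaves some
  slack.\<close>

lemma simulation_complete:
  assumes acc: "ntm_accepts_in M w t" and t: "t \<le> 2 ^ length w"
  shows "\<exists>e \<le> (12 * d + 5) * 2 ^ length w.
    (rewrite silent ^^ e) (Fill, \<emptyset>(Inp := map Bit (rev w))) (Clean, \<emptyset>)"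
proof -
  obtain q ts where run: "(ntm_step M ^^ t) (init M, snd (ntm_init M w)) (q, ts)" and q: "q \<in> final M"
    using acc by (auto simp: ntm_accepts_in_def ntm_init_def)
  let ?S = "rewrite silent"
  \<comment> \<open>Since a step of \<open>M\<close> consumes at most one cell of a stack,
    \<open>t\<close> blanks on each stack suffice for \<open>t\<close> steps.\<close>
  let ?B = "\<lambda>_ :: nat. replicate t (Blank :: bit symbol)"
  let ?R = "?B(0 := map Input w @ replicate t Blank)"
  have blank: "tape_split (replicate n Blank) (replicate n' Blank) (input_tape ([] :: bit list))" for n n'
    unfolding blank_tape_eq[symmetric]
    by (auto simp: tape_split_def blank_tape_def nth_default_def)
  have input: "tape_split (replicate n Blank) (map Input w @ replicate n' Blank) (input_tape w)" for n n'
    by (induction w) (auto intro: blank tape_split_input_push)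
  have "tape_split (?B j) (?R j) (snd (ntm_init M w) ! j) \<and> t \<le> length (?B j) \<and> t \<le> length (?R j)"
    if "j < d" for j
    using that blank input by (simp add: nth_ntm_init)
  from run_complete[OF run length_ntm_init this] obtain l r where
    lr: "(?S ^^ t) (Run (init M), on_tapes ?B ?R) (Run q, on_tapes l r)"
    "\<forall>j<d. length (l j) \<le> length (?B j) + t \<and> length (r j) \<le> length (?R j) + t"
    by blast
  define e where "e = (\<Sum>i\<in>tape_indices. length (on_tapes l r i))"
  have fin: "finite tape_indices"
    by (simp add: tape_indices_def)
  have "on_tapes l r i = []" if "i \<notin> tape_indices" for i
    using that by (cases i) (auto simp: tape_indices_def)
  then have clean: "(?S ^^ e) (Clean, on_tapes l r) (Clean, \<emptyset>)"
    unfolding e_def by (intro clean_complete fin) auto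
  have filled: "?S (Fill, s) (Load, s)" and loaded: "?S (Load, s) (Run (init M), s)"
    and halt: "?S (Run q, s) (Clean, s)" for s
    by (rule silentI[OF silent_filled, of _ s] silentI[OF silent_loaded, of _ s]
        silentI[OF silent_halt[OF q], of _ s]; simp)+
  let ?I = "\<emptyset>(Inp := map Bit (rev w))"
  have "(?S ^^ (card tape_indices * t)) (Fill, ?I) (Fill, on_tapes ?B ?B \<oplus> ?I)"
    by (rule fill_complete)
  moreover have "(?S ^^ 1) (Fill, on_tapes ?B ?B \<oplus> ?I) (Load, on_tapes ?B ?B \<oplus> ?I)"
    unfolding relpowp_1 by (rule filled)
  moreover have "(?S ^^ length w) (Load, on_tapes ?B ?B \<oplus> ?I) (Load, on_tapes ?B ?R)"
    by (rule load_complete)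
  moreover have "(?S ^^ 1) (Load, on_tapes ?B ?R) (Run (init M), on_tapes ?B ?R)"
    unfolding relpowp_1 by (rule loaded)
  moreover note lr(1)
  moreover have "(?S ^^ 1) (Run q, on_tapes l r) (Clean, on_tapes l r)"
    unfolding relpowp_1 by (rule halt)
  moreover note clean
  ultimately have "(?S ^^ (card tape_indices * t + 1 + length w + 1 + t + 1 + e)) (Fill, ?I) (Clean, \<emptyset>)"
    unfolding relpowp_add by blast
  moreover have "card tape_indices * t + 1 + length w + 1 + t + 1 + e \<le> (12 * d + 5) * 2 ^ length w"
  proof -
    let ?P = "2 ^ length w :: nat"
    have w: "length w \<le> ?P" "1 \<le> ?P"
      by (simp_all add: less_imp_le)
    have card: "card tape_indices \<le> 2 * d"
      using card_Un_le[of "Lft ` {..<d}" "Rgt ` {..<d}"] card_image_le[of "{..<d}" Lft]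
        card_image_le[of "{..<d}" Rgt]
      by (simp add: tape_indices_def)
    have "length (l j) \<le> 3 * ?P \<and> length (r j) \<le> 3 * ?P" if "j < d" for j
    proof -
      have "length (l j) \<le> t + t \<and> length (r j) \<le> length w + t + t"
        using lr(2)[rule_format, OF that] by (cases "j = 0") auto
      then show ?thesis
        using w t by linarith
    qed
    then have "length (on_tapes l r i) \<le> 3 * ?P" if "i \<in> tape_indices" for i
      using that by (auto simp: tape_indices_def)
    then have "e \<le> card tape_indices * (3 * ?P)"
      unfolding e_def by (rule sum_bounded_above[where 'a = nat, simplified])
    also have "\<dots> \<le> 2 * d * (3 * ?P)"
      by (intro mult_right_mono card) simp
    finally have e: "e \<le> 6 * (d * ?P)"
      by simp
    have "card tape_indices * t \<le> 2 * d * ?P"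
      by (intro mult_mono card t) simp_all
    then show ?thesis
      using e w t by (simp only: distrib_right mult.assoc)
  qed
  ultimately show ?thesis
    by blast
qed

section \<open>Distribution of the silent steps over the letters\<close>

lemma silent_simulating:
  assumes "(rewrite silent ^^ e) (q, s) (q', s')" "q \<in> {Fill, Load, Clean} \<union> range Run"
  shows "q' \<in> {Fill, Load, Clean} \<union> range Run \<and> s' (Cnt x) = s (Cnt x)"
  using assms(1)
proof (induction e arbitrary: q' s')
  case 0
  then show ?case using assms(2) by simp
next
  case (Suc e)
  then obtain q1 s1 where 1: "(rewrite silent ^^ e) (q, s) (q1, s1)" "rewrite silent (q1, s1) (q', s')"
    by auto
  from Suc.IH[OF 1(1)] have q1: "q1 \<in> {Fill, Load, Clean} \<union> range Run" "s1 (Cnt x) = s (Cnt x)"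
    by auto
  from 1(2) obtain u v r where "silent q1 u q' v" "s1 = u \<oplus> r" "s' = v \<oplus> r"
    by (auto elim: rewrite.cases)
  then show ?case
    using q1 by (cases rule: silent.cases) (auto simp: tape_indices_def)
qed

text \<open>Up to \<open>c\<close> silent steps are fitted in before each pop of a unit.\<close>

lemma interleave:
  assumes "(rewrite silent ^^ e) (q, s) (q', s')" "q \<in> {Fill, Load, Clean} \<union> range Run"
    and "\<And>x. s (Cnt x) = []" "e \<le> c * Suc m"
  shows "(chunk c ^^ Suc m) (q, s \<oplus> \<emptyset>(Cnt x := replicate (Suc m) Unit @ [Mark])) (q', s')"
  using assms
proof (induction m arbitrary: e q s)
  case 0
  let ?r = "\<emptyset>(Cnt x := [Unit, Mark])"
  have "(sup (=) (rewrite silent) ^^ c) (q, s) (q', s')"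
    using relpowp_sup_eq[OF 0(1)] 0(4) by simp
  then have "(sup (=) (rewrite silent) ^^ c) (q, s \<oplus> ?r) (q', s' \<oplus> ?r)"
    by (rule framedD[OF framed_silents])
  moreover have "q' \<in> {Fill, Load, Clean} \<union> range Run" "\<And>x. s' (Cnt x) = []"
    using silent_simulating[OF 0(1,2)] 0(3) by auto
  \<comment> \<open>The last unit is popped together with the mark, so that the counter ends
    empty.\<close>
  then have "rewrite tick (q', s' \<oplus> ?r) (q', s')"
    by (intro tickI[OF tick_last, of _ "[Unit, Mark]" _ x s']) (auto simp: fun_eq_iff)
  ultimately have "chunk c (q, s \<oplus> ?r) (q', s')"
    unfolding chunk_def by blast
  then have "(chunk c ^^ 1) (q, s \<oplus> ?r) (q', s')"
    by (simp only: relpowp_1)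
  then show ?case
    by (simp only: One_nat_def replicate.simps append.simps)
next
  case (Suc m)
  \<comment> \<open>Greedy choice: as many silent steps as fit before this pop. What is left over
    fits before the remaining ones.\<close>
  define e1 where "e1 = min c e"
  define e2 where "e2 = e - e1"
  have e: "e = e1 + e2" "e1 \<le> c" "e2 \<le> c * Suc m"
    using Suc.prems(4) by (auto simp: e1_def e2_def)
  obtain q1 s1 where 1: "(rewrite silent ^^ e1) (q, s) (q1, s1)" "(rewrite silent ^^ e2) (q1, s1) (q', s')"
    using Suc.prems(1) unfolding e(1) relpowp_add by auto
  have 2: "q1 \<in> {Fill, Load, Clean} \<union> range Run" "\<And>x. s1 (Cnt x) = []"
    using silent_simulating[OF 1(1) Suc.prems(2)] Suc.prems(3) by auto
  let ?r = "\<emptyset>(Cnt x := replicate (Suc (Suc m)) Unit @ [Mark])"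
  let ?r' = "\<emptyset>(Cnt x := replicate (Suc m) Unit @ [Mark])"
  from framedD[OF framed_silents relpowp_sup_eq[OF 1(1) e(2)]]
  have "(sup (=) (rewrite silent) ^^ c) (q, s \<oplus> ?r) (q1, s1 \<oplus> ?r)" .
  moreover have "rewrite tick (q1, s1 \<oplus> ?r) (q1, s1 \<oplus> ?r')"
    using 2 by (intro tickI[OF tick_last, of _ "[Unit]" _ x "s1 \<oplus> ?r'"]) (auto simp: fun_eq_iff)
  ultimately have "chunk c (q, s \<oplus> ?r) (q1, s1 \<oplus> ?r')"
    by (auto simp: chunk_def)
  from relpowp_Suc_I2[OF this Suc.IH[OF 1(2) 2 e(3)]] show ?case .
qed

lemma tick_chunk: "rewrite tick a b \<Longrightarrow> chunk c a b"
  using relpowp_sup_eq[of 0 "rewrite silent" a a c] by (auto simp: chunk_def)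

text \<open>The second claim makes room for \<open>silent_enter\<close> in front of the first letter
  of the last turn.\<close>

lemma chunk_Suc:
  assumes "chunk c a b"
  shows "chunk (Suc c) a b" and "rewrite silent a' a \<Longrightarrow> chunk (Suc c) a' b"
proof -
  obtain a1 where 1: "(sup (=) (rewrite silent) ^^ c) a a1" "rewrite tick a1 b"
    using assms by (auto simp: chunk_def)
  have "(sup (=) (rewrite silent) ^^ Suc c) a' a1" if "a' = a \<or> rewrite silent a' a" for a'
    using that 1(1) by (intro relpowp_Suc_I2[of _ a' a]) (auto simp: sup_fun_def)
  with 1(2) show "chunk (Suc c) a b" "rewrite silent a' a \<Longrightarrow> chunk (Suc c) a' b"
    unfolding chunk_def by blast+
qed

text \<open>After \<open>p\<close> letters, at least \<open>p\<close> remain. The word has two bits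
  more than \<open>v'\<close>, so \<open>2 ^ length w\<close> is at most \<open>4 * p\<close>; this
  is the factor 4 in \<open>c\<close>. The successor pays for the step that enters the
  simulation.\<close>

lemma chunks_complete:
  assumes c: "c = 4 * (12 * d + 5)" and w: "w = One # v"
    and acc: "ntm_accepts_in M w t" and t: "t \<le> 2 ^ length w"
  shows "(chunk (Suc c) ^^ length (pad w)) (Start, \<emptyset>) (Clean, \<emptyset>)"
proof (cases v rule: rev_cases)
  case Nil
  \<comment> \<open>The word \<open>[One]\<close> has no turn in which a simulation could take
    place, so its membership is built into the rule \<open>tick_short\<close>.\<close>
  have "[One] \<in> ntm_language M"
    using acc w Nil by (auto simp: ntm_language_def)
  then have "rewrite tick (Start, \<emptyset>) (Clean, \<emptyset>)"
    by (intro tickI[OF tick_short, of _ \<emptyset>]) auto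
  then show ?thesis
    using w Nil by (simp add: length_pad_One tick_chunk relcompp_apply)
next
  case (snoc v' b)
  define p where "p = length (pad (One # v'))"
  have len: "length (pad w) = p + (p + of_bool (b = One))"
    using length_pad_snoc[of "One # v'" b] by (simp add: p_def w snoc)
  obtain m where m: "p + of_bool (b = One) = Suc m"
    using pad_ge[of v'] by (cases "p + of_bool (b = One)") (auto simp: p_def)
  obtain x where x: "(rewrite tick ^^ p) (Start, \<emptyset>) (Count x, counting x (One # v') p)"
    using count_complete[of v'] by (auto simp: p_def)
  let ?I = "\<emptyset>(Inp := map Bit (rev w))"
  let ?s = "?I \<oplus> \<emptyset>(Cnt x := replicate (Suc m) Unit @ [Mark])"
  have enter: "rewrite silent (Count x, counting x (One # v') p) (Fill, ?s)"
  proof (rule silentI[OF silent_enter])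
    let ?r = "\<emptyset>(Cnt x := replicate p Unit @ [Mark], Inp := map Bit (rev (One # v')))"
    show "counting x (One # v') p = \<emptyset>(Cnt (\<not> x) := [Mark]) \<oplus> ?r"
      by (rule index_eqI[of _ x]) (simp_all add: p_def)
    show "?s = \<emptyset>(Cnt x := (if b = One then [Unit] else []), Inp := [Bit b]) \<oplus> ?r"
      unfolding m[symmetric] by (rule index_eqI[of _ x]) (auto simp: w snoc)
  qed
  obtain e where e: "e \<le> (12 * d + 5) * 2 ^ length w" "(rewrite silent ^^ e) (Fill, ?I) (Clean, \<emptyset>)"
    using simulation_complete[OF acc t] by blast
  have "(2::nat) ^ length w = 4 * 2 ^ length v'"
    by (simp add: w snoc)
  also have "\<dots> \<le> 4 * p"
    using pad_ge[of v'] by (simp add: p_def)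
  also have "\<dots> \<le> 4 * Suc m"
    using m by (cases "b = One") auto
  finally have "(12 * d + 5) * 2 ^ length w \<le> (12 * d + 5) * (4 * Suc m)"
    by (rule mult_left_mono) simp
  also have "\<dots> = c * Suc m"
    by (simp add: c algebra_simps)
  finally have "(chunk c ^^ Suc m) (Fill, ?s) (Clean, \<emptyset>)"
    using e by (intro interleave[OF e(2)]) auto
  \<comment> \<open>The first chunk is split off, because the entering step has to be put in front
    of it.\<close>
  then obtain a where a: "chunk c (Fill, ?s) a" "(chunk c ^^ m) a (Clean, \<emptyset>)"
    using relpowp_Suc_D2 by metis
  have "(chunk (Suc c) ^^ Suc m) (Count x, counting x (One # v') p) (Clean, \<emptyset>)"
    using chunk_Suc(2)[OF a(1) enter] relpowp_mono[OF chunk_Suc(1) a(2)] by (rule relpowp_Suc_I2)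
  moreover have "(chunk (Suc c) ^^ p) (Start, \<emptyset>) (Count x, counting x (One # v') p)"
    using relpowp_mono[OF tick_chunk x] .
  ultimately show ?thesis
    unfolding len m relpowp_add by blast
qed

end

theorem theorem1:
  fixes L :: "bit list set"
  assumes "L \<subseteq> {One # v | v. True}"
    and "L \<in> NTIME (\<lambda>n. 2 ^ n)"
  shows "\<exists>M. is_rtm M \<and> rtm_language M = {pad w | w. w \<in> L}"
proof -
  from assms(2) obtain N where N: "is_ntm N" "ntm_language N = L"
    "\<And>w. w \<in> L \<Longrightarrow> \<exists>t\<le>2 ^ length w. ntm_accepts_in N w t"
    unfolding NTIME_def by blast
  interpret simulation N
    by standard (rule N)
  define c where "c = 4 * (12 * num_tapes N + 5)"
  interpret local_system "2 * Suc c + 2" phases indices cells "chunk (Suc c)" Start "{Clean}"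
    by (rule local_system_chunk)
  have pad: "replicate (length (pad w)) Letter_a = pad w" for w
    by (rule replicate_eqI[symmetric]) (auto intro: letter.exhaust)
  have "(chunk (Suc c) ^^ n) (Start, \<emptyset>) (Clean, \<emptyset>) \<longleftrightarrow> (\<exists>w\<in>L. n = length (pad w))" for n
  proof
    assume "(chunk (Suc c) ^^ n) (Start, \<emptyset>) (Clean, \<emptyset>)"
    from chunks_sound[OF this] show "\<exists>w\<in>L. n = length (pad w)"
      unfolding N(2) .
  next
    assume "\<exists>w\<in>L. n = length (pad w)"
    then obtain w where w: "w \<in> L" "n = length (pad w)"
      by blast
    then obtain v t where "w = One # v" "t \<le> 2 ^ length w" "ntm_accepts_in N w t"
      using assms(1) N(3) by blast
    then show "(chunk (Suc c) ^^ n) (Start, \<emptyset>) (Clean, \<emptyset>)"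
      using chunks_complete[OF c_def] w(2) by blast
  qed
  then have "rtm_language rt_machine = {pad w | w. w \<in> L}"
    unfolding rt_language using pad by auto metis+
  then show ?thesis
    using is_rtm_rt_machine by blast
qed

end
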